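(* Let $H\in(0,\frac12)$ and $T>0$, let $B^H$ be a fractional Brownian motion with Hurst index $H$ and $W$ a Wiener process independent of $B^H$. The asymptotic behaviour of the small deviation $-\log\mathbb P\left(\sup_{0\le t\le T}|W(t)+B^H(t)|\le\varepsilon\right)$ of the mixed fractional Brownian motion is the same as the one for $B^H$, i.e. $$-\log\mathbb P\left(\sup_{0\le t\le T}|B^H(t)+W(t)|\le\varepsilon\right)\sim\varepsilon^{-\frac1H}\qquad\text{as }\varepsilon\to0.$$
   Context: Here $a(\varepsilon)\sim b(\varepsilon)$ as $\varepsilon\to0$ means that the asymptotic behaviours of $a$ and $b$ are the same up to a constant multiplier, i.e. there are constants $0<c\le C<\infty$ with $c\,b(\varepsilon)\le a(\varepsilon)\le C\,b(\varepsilon)$ for all sufficiently small $\varepsilon>0$. It is known that $-\log\mathbb P(\sup_{0\le t\le T}|B^H(t)|\le\varepsilon)\sim\varepsilon^{-1/H}$. A fractional Brownian motion with Hurst index $H$ is a centered Gaussian process (with continuous paths) with covariance $\frac12(t^{2H}+s^{2H}-|t-s|^{2H})$. *)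

theory Defs
  imports "HOL-Probability.Probability"
begin

text \<open>Agreement of asymptotic behaviour up to a constant multiplier, as the argument tends to 0
  from the right.\<close>

definition same_order_at_0 :: "(real \<Rightarrow> real) \<Rightarrow> (real \<Rightarrow> real) \<Rightarrow> bool" where
  "same_order_at_0 a b \<longleftrightarrow>
     (\<exists>c C. 0 < c \<and> c \<le> C \<and>
        (\<forall>\<^sub>F \<epsilon> in at_right 0. c * b \<epsilon> \<le> a \<epsilon> \<and> a \<epsilon> \<le> C * b \<epsilon>))"

text \<open>Real processes are functions \<open>X :: real \<Rightarrow> 'a \<Rightarrow> real\<close> of time and outcome; only the
  times \<open>t \<ge> 0\<close> are relevant.\<close>

definition continuous_paths :: "'a measure \<Rightarrow> (real \<Rightarrow> 'a \<Rightarrow> real) \<Rightarrow> bool" where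
  "continuous_paths M X \<longleftrightarrow> (\<forall>\<omega>\<in>space M. continuous_on {0..} (\<lambda>t. X t \<omega>))"

context prob_space
begin

definition covariance :: "('a \<Rightarrow> real) \<Rightarrow> ('a \<Rightarrow> real) \<Rightarrow> real" where
  "covariance X Y = expectation (\<lambda>\<omega>. (X \<omega> - expectation X) * (Y \<omega> - expectation Y))"

text \<open>The second disjunct is the degenerate (zero variance) normal law, which has no density.\<close>

definition gaussian_variable :: "('a \<Rightarrow> real) \<Rightarrow> bool" where
  "gaussian_variable X \<longleftrightarrow> random_variable borel X \<and>
     ((\<exists>\<mu> \<sigma>. 0 < \<sigma> \<and> distributed M lborel X (normal_density \<mu> \<sigma>)) \<or>
      (\<exists>\<mu>. AE \<omega> in M. X \<omega> = \<mu>))"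

text \<open>All finite-dimensional distributions are (possibly degenerate) multivariate normal laws,
  that is, every finite linear combination is a normal variable.\<close>

definition gaussian_process :: "(real \<Rightarrow> 'a \<Rightarrow> real) \<Rightarrow> bool" where
  "gaussian_process X \<longleftrightarrow>
     (\<forall>I (c :: real \<Rightarrow> real). finite I \<and> I \<subseteq> {0..} \<longrightarrow>
        gaussian_variable (\<lambda>\<omega>. \<Sum>t\<in>I. c t * X t \<omega>))"

definition fractional_brownian_motion :: "real \<Rightarrow> (real \<Rightarrow> 'a \<Rightarrow> real) \<Rightarrow> bool" where
  "fractional_brownian_motion H B \<longleftrightarrow>
     gaussian_process B \<and>
     (\<forall>t\<ge>0. expectation (B t) = 0) \<and>
     (\<forall>s\<ge>0. \<forall>t\<ge>0. covariance (B t) (B s) =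
        1 / 2 * (t powr (2 * H) + s powr (2 * H) - \<bar>t - s\<bar> powr (2 * H))) \<and>
     continuous_paths M B"

definition wiener_process :: "(real \<Rightarrow> 'a \<Rightarrow> real) \<Rightarrow> bool" where
  "wiener_process W \<longleftrightarrow>
     (\<forall>t\<ge>0. random_variable borel (W t)) \<and>
     (AE \<omega> in M. W 0 \<omega> = 0) \<and>
     (\<forall>(n :: nat) \<tau>. 0 \<le> \<tau> 0 \<and> mono \<tau> \<longrightarrow>
        indep_vars (\<lambda>_. borel) (\<lambda>i \<omega>. W (\<tau> (Suc i)) \<omega> - W (\<tau> i) \<omega>) {..<n}) \<and>
     (\<forall>s t. 0 \<le> s \<and> s < t \<longrightarrow>
        distributed M lborel (\<lambda>\<omega>. W t \<omega> - W s \<omega>) (normal_density 0 (sqrt (t - s)))) \<and>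
     continuous_paths M W"

text \<open>Independence as random elements of the product space, not merely for each fixed time.\<close>

definition independent_processes ::
  "(real \<Rightarrow> 'a \<Rightarrow> real) \<Rightarrow> (real \<Rightarrow> 'a \<Rightarrow> real) \<Rightarrow> bool" where
  "independent_processes X Y \<longleftrightarrow>
     indep_var (\<Pi>\<^sub>M t\<in>{0..}. borel) (\<lambda>\<omega>. \<lambda>t\<in>{0..}. X t \<omega>)
               (\<Pi>\<^sub>M t\<in>{0..}. borel) (\<lambda>\<omega>. \<lambda>t\<in>{0..}. Y t \<omega>)"

definition small_ball_prob :: "real \<Rightarrow> (real \<Rightarrow> 'a \<Rightarrow> real) \<Rightarrow> real \<Rightarrow> real" where
  "small_ball_prob T X \<epsilon> = prob {\<omega> \<in> space M. (SUP t\<in>{0..T}. \<bar>X t \<omega>\<bar>) \<le> \<epsilon>}"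

end

end

theory Submission
  imports Defs
begin

text \<open>Both bounds rest on elementary properties of \<open>X = B + W\<close>.

  Upper bound on the probability: the increments \<open>Z\<^sub>k\<close> of \<open>X\<close> over every second interval of a grid
  of mesh \<open>u\<close> satisfy \<open>|E exp (i \<Sum> \<xi>\<^sub>k Z\<^sub>k)| \<le> exp (- c u\<^sup>2\<^sup>H |\<xi>|\<^sup>2 / 2)\<close>: independence allows to drop
  \<open>W\<close>, and for \<open>H < 1/2\<close> the increments of \<open>B\<close> are negatively correlated with summable, telescoping
  covariances, so that leaving out every second one makes the covariance matrix strictly diagonally
  dominant. Averaging over standard normal \<open>\<xi>\<close> bounds \<open>E exp (- \<Sum> Z\<^sub>k\<^sup>2 / (2 \<epsilon>\<^sup>2))\<close>, hence the
  probability that all \<open>|Z\<^sub>k|\<close> are at most \<open>2 \<epsilon>\<close>, exponentially in the number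
  \<open>n \<sim> \<epsilon>\<^sup>-\<^sup>1\<^sup>/\<^sup>H\<close> of increments.

  Lower bound: if \<open>X'\<close> is an independent copy of \<open>X\<close>, then \<open>(X - X') / \<surd>2\<close> has the law of \<open>X\<close>, so it
  suffices that \<open>X\<close> and \<open>X'\<close> stay close, for example because their quantizations agree. The chaining
  increments of \<open>X\<close>, rounded with a precision that decreases geometrically below the scale
  \<open>\<epsilon>\<^sup>1\<^sup>/\<^sup>H\<close>, are encoded by a word of expected length \<open>L\<close> of order \<open>\<epsilon>\<^sup>-\<^sup>1\<^sup>/\<^sup>H\<close>; by Kraft's inequality
  with probability at least 1/2 the word is among \<open>exp (2 L)\<close> ones, so two independent words coincide
  with probability at least \<open>exp (- 2 L) / 4\<close>. No correlation inequality is needed.\<close>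

section \<open>Uniqueness of Fourier transforms on rectangles\<close>

text \<open>Levy's uniqueness theorem speaks of probability measures. The value of a characteristic
  function at 0 is the total mass, so both measures have the same mass and can be normalised by it;
  mass 0 is treated apart.\<close>

lemma finite_measure_char_unique:
  fixes M N :: "real measure"
  assumes "finite_measure M" "finite_measure N"
    and M: "sets M = sets borel" and N: "sets N = sets borel"
    and eq: "char M = char N"
  shows "M = N"
proof -
  interpret M: finite_measure M by fact
  interpret N: finite_measure N by fact
  have spM: "space M = UNIV" and spN: "space N = UNIV"
    using sets_eq_imp_space_eq[OF M] sets_eq_imp_space_eq[OF N] by auto
  have c0: "char L 0 = of_real (measure L (space L))" if "finite_measure L" for L :: "real measure"
    by (simp add: char_def of_real_def)
  have mass: "measure M UNIV = measure N UNIV"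
    using c0[OF assms(1)] c0[OF assms(2)] eq spM spN by simp
  define c where "c = measure M UNIV"
  show ?thesis
  proof (cases "c = 0")
    case True
    show ?thesis
    proof (rule measure_eqI)
      fix A assume "A \<in> sets M"
      have "measure M A = 0" "measure N A = 0"
        using True mass M.bounded_measure[of A] N.bounded_measure[of A] spM spN
        by (auto simp: c_def measure_le_0_iff)
      then show "emeasure M A = emeasure N A"
        by (simp add: M.emeasure_eq_measure N.emeasure_eq_measure)
    qed (simp add: M N)
  next
    case False
    then have c: "c > 0" by (simp add: c_def zero_less_measure_iff)
    have real: "real_distribution (density L (\<lambda>_. ennreal (1 / c)))"
      if "finite_measure L" "sets L = sets borel" "measure L UNIV = c" for L :: "real measure"
    proof -
      interpret L: finite_measure L by fact
      have sp: "space L = UNIV" using sets_eq_imp_space_eq[OF that(2)] by simp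
      have "emeasure (density L (\<lambda>_. ennreal (1 / c))) UNIV = ennreal (1 / c) * ennreal c"
        using that by (subst emeasure_density_const) (auto simp: L.emeasure_eq_measure)
      also have "\<dots> = 1" using c by (simp flip: ennreal_mult)
      finally show ?thesis
        by (intro real_distribution.intro prob_spaceI real_distribution_axioms.intro)
          (auto simp: that sp)
    qed
    have ch: "char (density L (\<lambda>_. ennreal (1 / c))) = (\<lambda>t. char L t / c)"
      if "sets L = sets borel" for L :: "real measure"
    proof
      fix t
      have "char (density L (\<lambda>_. ennreal (1 / c))) t = (CLINT x|L. (1 / c) *\<^sub>R iexp (t * x))"
        unfolding char_def using that c
        by (intro integral_density) (auto simp: measurable_cong_sets[OF that refl])
      then show "char (density L (\<lambda>_. ennreal (1 / c))) t = char L t / c"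
        by (simp add: char_def scaleR_conv_of_real)
    qed
    have "density M (\<lambda>_. ennreal (1 / c)) = density N (\<lambda>_. ennreal (1 / c))"
      using mass ch[OF M] ch[OF N] eq
      by (intro Levy_uniqueness real) (simp_all add: assms(1,2) M N c_def)
    then have eq': "emeasure (density M (\<lambda>_. ennreal (1 / c))) A = emeasure (density N (\<lambda>_. ennreal (1 / c))) A" for A
      by simp
    show ?thesis
    proof (rule measure_eqI)
      fix A assume "A \<in> sets M"
      then have "ennreal (1 / c) * emeasure M A = ennreal (1 / c) * emeasure N A"
        using eq'[of A] by (simp add: emeasure_density_const M N)
      then have "ennreal c * (ennreal (1 / c) * emeasure M A) = ennreal c * (ennreal (1 / c) * emeasure N A)"
        by simp
      then show "emeasure M A = emeasure N A"
        using c by (simp add: mult.assoc[symmetric] flip: ennreal_mult)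
    qed (simp add: M N)
  qed
qed

text \<open>A weighted Fourier integral is the characteristic function of the image under
  \<open>X\<close> of the measure with density \<open>f\<close>. Nonnegative bounded weights make
  this a finite measure, so uniqueness for finite measures applies.\<close>

lemma weighted_fourier_unique:
  fixes f X :: "'a \<Rightarrow> real" and g Y :: "'b \<Rightarrow> real"
  assumes "prob_space M" "prob_space N"
    and [measurable]: "f \<in> borel_measurable M" "X \<in> borel_measurable M"
      "g \<in> borel_measurable N" "Y \<in> borel_measurable N" "A \<in> sets borel"
    and f: "\<And>x. 0 \<le> f x" "\<And>x. f x \<le> K" and g: "\<And>x. 0 \<le> g x" "\<And>x. g x \<le> K"
    and eq: "\<And>s. (CLINT x|M. f x * iexp (s * X x)) = (CLINT x|N. g x * iexp (s * Y x))"
  shows "(LINT x|M. f x * indicator A (X x)) = (LINT x|N. g x * indicator A (Y x))"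
proof -
  have gen: "finite_measure (distr (density L (\<lambda>x. ennreal (h x))) borel Z)
      \<and> char (distr (density L (\<lambda>x. ennreal (h x))) borel Z) = (\<lambda>s. CLINT x|L. h x * iexp (s * Z x))
      \<and> measure (distr (density L (\<lambda>x. ennreal (h x))) borel Z) A = (LINT x|L. h x * indicator A (Z x))"
    if "prob_space L" and [measurable]: "h \<in> borel_measurable L" "Z \<in> borel_measurable L"
      and h: "\<And>x. 0 \<le> h x" "\<And>x. h x \<le> K" for L :: "'c measure" and h Z
  proof -
    interpret L: prob_space L by fact
    have int: "integrable L h"
      by (rule L.integrable_const_bound[where B = K]) (use h in auto)
    have "emeasure (density L (\<lambda>x. ennreal (h x))) (space L) = ennreal (LINT x|L. h x)"
      using int h by (subst emeasure_density) (auto simp: nn_integral_eq_integral cong: nn_integral_cong)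
    then have fin: "finite_measure (density L (\<lambda>x. ennreal (h x)))"
      by (intro finite_measureI) simp
    have 1: "finite_measure (distr (density L (\<lambda>x. ennreal (h x))) borel Z)"
      by (intro finite_measure.finite_measure_distr[OF fin]) simp
    have 2: "char (distr (density L (\<lambda>x. ennreal (h x))) borel Z) = (\<lambda>s. CLINT x|L. h x * iexp (s * Z x))"
      by (rule ext) (simp add: char_def integral_distr integral_density h scaleR_conv_of_real)
    have "measure (distr (density L (\<lambda>x. ennreal (h x))) borel Z) A
        = (LINT y|distr (density L (\<lambda>x. ennreal (h x))) borel Z. indicator A y)"
      by simp
    also have "\<dots> = (LINT x|L. h x * indicator A (Z x))"
      by (subst integral_distr) (auto simp: integral_density h)
    finally show ?thesis using 1 2 by blast
  qed
  have "distr (density M (\<lambda>x. ennreal (f x))) borel X = distr (density N (\<lambda>x. ennreal (g x))) borel Y"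
    using gen[of M f X] gen[of N g Y] assms by (intro finite_measure_char_unique) auto
  then show ?thesis
    using gen[of M f X] gen[of N g Y] assms by simp
qed


text \<open>Splitting the cosine into two exponentials leaves Fourier integrals with weight
  \<open>p\<close> at the phases \<open>V\<close>, \<open>V + U\<close> and \<open>V - U\<close>. A
  weight admissible for the uniqueness theorem is thus controlled by integrals about which an
  induction hypothesis can speak.\<close>

lemma weighted_fourier_cos:
  fixes p U V :: "'a \<Rightarrow> real"
  assumes "prob_space M" and [measurable]: "p \<in> borel_measurable M" "U \<in> borel_measurable M" "V \<in> borel_measurable M"
    and p: "\<And>x. 0 \<le> p x" "\<And>x. p x \<le> 1"
  shows "(CLINT x|M. of_real (p x * (1 + cos (U x + c))) * iexp (V x)) =
      (CLINT x|M. p x * iexp (V x)) +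
      iexp c / 2 * (CLINT x|M. p x * iexp (U x + V x)) + iexp (- c) / 2 * (CLINT x|M. p x * iexp (- U x + V x))"
proof -
  interpret prob_space M by fact
  have int: "integrable M (\<lambda>x. p x * iexp (Z x))" if [measurable]: "Z \<in> borel_measurable M" for Z
    by (rule integrable_const_bound[where B = 1]) (use p in \<open>auto simp: norm_mult\<close>)
  have "of_real (p x * (1 + cos (U x + c))) * iexp (V x) =
      p x * iexp (V x) + (iexp c / 2 * (p x * iexp (U x + V x)) + iexp (- c) / 2 * (p x * iexp (- U x + V x)))" for x
  proof -
    have "of_real (cos (U x + c)) = (iexp c * iexp (U x) + iexp (- c) * iexp (- U x)) / 2"
      by (simp add: cos_of_real[symmetric] cos_exp_eq exp_add[symmetric] algebra_simps)
    moreover have "iexp (U x + V x) = iexp (U x) * iexp (V x)"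
      by (simp add: exp_add distrib_left)
    moreover have "iexp (- U x + V x) = iexp (- U x) * iexp (V x)"
      by (simp add: exp_add[symmetric] algebra_simps)
    ultimately show ?thesis
      by (simp only: of_real_mult of_real_add of_real_1) (simp add: algebra_simps)
  qed
  then show ?thesis
    using int[of V] int[of "\<lambda>x. U x + V x"] int[of "\<lambda>x. - U x + V x"]
    by (simp add: add.assoc del: of_real_minus of_real_add of_real_mult)
qed

text \<open>The way back from nonnegative weights to a complex exponential: subtracting the
  contribution of the constant 1 leaves \<open>cos U\<close> for the shift 0 and
  \<open>sin U\<close> for the shift \<open>- (pi / 2)\<close>, the real and imaginary
  parts.\<close>

lemma weighted_fourier_indicator:
  fixes p U V :: "'a \<Rightarrow> real"
  assumes "prob_space M" and [measurable]: "p \<in> borel_measurable M" "U \<in> borel_measurable M" "V \<in> borel_measurable M"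
      "A \<in> sets borel"
    and p: "\<And>x. 0 \<le> p x" "\<And>x. p x \<le> 1"
  shows "(CLINT x|M. of_real (p x * indicator A (V x)) * iexp (U x)) =
      Complex ((LINT x|M. p x * (1 + cos (U x + 0)) * indicator A (V x)) - (LINT x|M. p x * indicator A (V x)))
        ((LINT x|M. p x * (1 + cos (U x + - (pi / 2))) * indicator A (V x)) - (LINT x|M. p x * indicator A (V x)))"
proof -
  interpret prob_space M by fact
  have int: "integrable M (\<lambda>x. p x * Z x * indicator A (V x))"
    if [measurable]: "Z \<in> borel_measurable M" and Z: "\<And>x. \<bar>Z x\<bar> \<le> 1" for Z :: "'a \<Rightarrow> real"
  proof (rule integrable_const_bound[where B = 1])
    have "\<bar>p x * Z x * indicator A (V x)\<bar> \<le> 1 * 1 * 1" for x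
      unfolding abs_mult using p Z[of x] by (intro mult_mono) (auto simp: indicator_def)
    then show "AE x in M. norm (p x * Z x * indicator A (V x)) \<le> 1" by simp
  qed simp
  have i1: "integrable M (\<lambda>x. p x * indicator A (V x))" using int[of "\<lambda>_. 1"] by simp
  have c: "integrable M (\<lambda>x. p x * indicator A (V x) * cos (U x))"
    and s: "integrable M (\<lambda>x. p x * indicator A (V x) * sin (U x))"
    using int[of "\<lambda>x. cos (U x)"] int[of "\<lambda>x. sin (U x)"] by (simp_all add: mult_ac)
  have r: "(LINT x|M. p x * (1 + w x) * indicator A (V x)) - (LINT x|M. p x * indicator A (V x))
      = (LINT x|M. p x * indicator A (V x) * w x)"
    if "integrable M (\<lambda>x. p x * indicator A (V x) * w x)" for w :: "'a \<Rightarrow> real"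
    using i1 that by (simp add: distrib_left distrib_right mult_ac)
  have "(CLINT x|M. of_real (p x * indicator A (V x)) * iexp (U x)) =
     (CLINT x|M. of_real (p x * indicator A (V x) * cos (U x)) + \<i> * of_real (p x * indicator A (V x) * sin (U x)))"
    by (intro Bochner_Integration.integral_cong refl)
      (simp add: exp_Euler cos_of_real sin_of_real algebra_simps)
  also have "\<dots> = of_real (LINT x|M. p x * indicator A (V x) * cos (U x))
      + \<i> * of_real (LINT x|M. p x * indicator A (V x) * sin (U x))"
    using c s by (subst Bochner_Integration.integral_add) (auto simp del: of_real_mult)
  also have "\<dots> = Complex (LINT x|M. p x * indicator A (V x) * cos (U x)) (LINT x|M. p x * indicator A (V x) * sin (U x))"
    by (simp add: complex_eq_iff)
  moreover have "cos (u + - (pi / 2)) = sin u" for u :: real by (simp add: cos_diff)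
  ultimately show ?thesis
    by (simp only: r[OF c] r[OF s] add_0_right)
qed

text \<open>The frequencies still range over all of \<open>I\<close> after some coordinates have been restricted to
  sets; this makes the induction work, with the one-dimensional uniqueness theorem applied to the
  nonnegative weights \<open>1 + cos (\<theta> \<bullet> X + c)\<close>.\<close>

lemma rectangle_fourier:
  fixes X :: "'i \<Rightarrow> 'a \<Rightarrow> real" and Y :: "'i \<Rightarrow> 'b \<Rightarrow> real"
  assumes "prob_space M" "prob_space N" "finite I"
    and X: "\<And>i. i \<in> I \<Longrightarrow> X i \<in> borel_measurable M"
    and Y: "\<And>i. i \<in> I \<Longrightarrow> Y i \<in> borel_measurable N"
    and A: "\<And>i. i \<in> I \<Longrightarrow> A i \<in> sets borel"
    and eq: "\<And>\<theta>. (CLINT x|M. iexp (\<Sum>i\<in>I. \<theta> i * X i x)) = (CLINT x|N. iexp (\<Sum>i\<in>I. \<theta> i * Y i x))"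
    and "F \<subseteq> I"
  shows "(CLINT x|M. of_real (\<Prod>i\<in>F. indicator (A i) (X i x)) * iexp (\<Sum>i\<in>I. \<theta> i * X i x)) =
    (CLINT x|N. of_real (\<Prod>i\<in>F. indicator (A i) (Y i x)) * iexp (\<Sum>i\<in>I. \<theta> i * Y i x))"
proof -
  have "finite F" using \<open>F \<subseteq> I\<close> \<open>finite I\<close> by (rule finite_subset)
  then show ?thesis using \<open>F \<subseteq> I\<close>
  proof (induction F arbitrary: \<theta>)
    case empty
    then show ?case using eq by simp
  next
    case (insert a F)
    define pX where "pX x = (\<Prod>i\<in>F. indicator (A i) (X i x) :: real)" for x
    define pY where "pY x = (\<Prod>i\<in>F. indicator (A i) (Y i x) :: real)" for x
    define SX where "SX t x = (\<Sum>i\<in>I. t i * X i x)" for t x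
    define SY where "SY t x = (\<Sum>i\<in>I. t i * Y i x)" for t x
    have "a \<in> I" and FI: "F \<subseteq> I" using insert.prems by auto
    have [measurable]: "i \<in> F \<Longrightarrow> X i \<in> borel_measurable M" "i \<in> F \<Longrightarrow> Y i \<in> borel_measurable N"
      "i \<in> I \<Longrightarrow> X i \<in> borel_measurable M" "i \<in> I \<Longrightarrow> Y i \<in> borel_measurable N"
      "i \<in> F \<Longrightarrow> A i \<in> sets borel" for i using FI X Y A by auto
    have [measurable]: "pX \<in> borel_measurable M" "pY \<in> borel_measurable N"
      "SX t \<in> borel_measurable M" "SY t \<in> borel_measurable N" for t
      unfolding pX_def[abs_def] pY_def[abs_def] SX_def[abs_def] SY_def[abs_def] by measurable
    have [measurable]: "X a \<in> borel_measurable M" "Y a \<in> borel_measurable N" "A a \<in> sets borel"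
      using \<open>a \<in> I\<close> X Y A by auto
    have pX: "0 \<le> pX x" "pX x \<le> 1" for x
      unfolding pX_def by (auto intro!: prod_nonneg prod_le_1)
    have pY: "0 \<le> pY x" "pY x \<le> 1" for x
      unfolding pY_def by (auto intro!: prod_nonneg prod_le_1)
    have IH: "(CLINT x|M. pX x * iexp (SX t x)) = (CLINT x|N. pY x * iexp (SY t x))" for t
      using insert.IH[OF FI, of t] by (simp add: pX_def pY_def SX_def SY_def)
    \<comment> \<open>Frequencies supported on \<open>a\<close> alone, so that the one-dimensional
      transform in \<open>X a\<close> is an instance of the induction hypothesis.\<close>
    define e where "e s i = (if i = a then s else 0 :: real)" for s i
    have eX: "SX (e s) x = s * X a x" for s x
      using \<open>finite I\<close> \<open>a \<in> I\<close> unfolding SX_def e_def by (subst sum.remove[of _ a]) auto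
    have eY: "SY (e s) x = s * Y a x" for s x
      using \<open>finite I\<close> \<open>a \<in> I\<close> unfolding SY_def e_def by (subst sum.remove[of _ a]) auto
    have add: "SX t x + SX u x = SX (\<lambda>i. t i + u i) x" "SY t y + SY u y = SY (\<lambda>i. t i + u i) y"
      "- SX t x = SX (\<lambda>i. - t i) x" "- SY t y = SY (\<lambda>i. - t i) y" for t u x y
      by (simp_all add: SX_def SY_def distrib_right sum.distrib sum_negf)
    have W0: "(CLINT x|M. pX x * iexp (s * X a x)) = (CLINT x|N. pY x * iexp (s * Y a x))" for s
      using IH[of "e s"] by (simp only: eX eY)
    \<comment> \<open>The phases produced by the cosine expansion are again linear combinations of
      the coordinates, hence covered by \<open>IH\<close>.\<close>
    have W: "(CLINT x|M. of_real (pX x * (1 + cos (SX \<theta> x + c))) * iexp (s * X a x)) =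
        (CLINT x|N. of_real (pY x * (1 + cos (SY \<theta> x + c))) * iexp (s * Y a x))" for s c
    proof -
      have mX: "(CLINT x|M. of_real (pX x * (1 + cos (SX \<theta> x + c))) * iexp (SX (e s) x)) =
          (CLINT x|M. pX x * iexp (SX (e s) x)) +
          iexp c / 2 * (CLINT x|M. pX x * iexp (SX \<theta> x + SX (e s) x)) +
          iexp (- c) / 2 * (CLINT x|M. pX x * iexp (- SX \<theta> x + SX (e s) x))"
        by (rule weighted_fourier_cos[OF assms(1)]) (use pX in measurable)
      have mY: "(CLINT x|N. of_real (pY x * (1 + cos (SY \<theta> x + c))) * iexp (SY (e s) x)) =
          (CLINT x|N. pY x * iexp (SY (e s) x)) +
          iexp c / 2 * (CLINT x|N. pY x * iexp (SY \<theta> x + SY (e s) x)) +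
          iexp (- c) / 2 * (CLINT x|N. pY x * iexp (- SY \<theta> x + SY (e s) x))"
        by (rule weighted_fourier_cos[OF assms(2)]) (use pY in measurable)
      have "(CLINT x|M. of_real (pX x * (1 + cos (SX \<theta> x + c))) * iexp (SX (e s) x)) =
          (CLINT x|N. of_real (pY x * (1 + cos (SY \<theta> x + c))) * iexp (SY (e s) x))"
        unfolding mX mY by (simp only: add IH)
      then show ?thesis by (simp only: eX eY)
    qed
    have bd: "0 \<le> 1 + cos u" "1 + cos u \<le> 2" for u :: real
      using cos_ge_minus_one[of u] cos_le_one[of u] by linarith+
    have b: "0 \<le> q * (1 + cos u)" "q * (1 + cos u) \<le> 2" if "0 \<le> q" "q \<le> 1" for q u :: real
      using bd[of u] that mult_mono[of q 1 "1 + cos u" 2] by auto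
    have L0: "(LINT x|M. pX x * indicator (A a) (X a x)) = (LINT x|N. pY x * indicator (A a) (Y a x))"
      by (rule weighted_fourier_unique[OF assms(1,2), where K = 1]) (use pX pY W0 in auto)
    have L: "(LINT x|M. pX x * (1 + cos (SX \<theta> x + c)) * indicator (A a) (X a x))
        = (LINT x|N. pY x * (1 + cos (SY \<theta> x + c)) * indicator (A a) (Y a x))" for c
      by (rule weighted_fourier_unique[OF assms(1,2), where K = 2]) (use b pX pY W in auto)
    have "(CLINT x|M. of_real (pX x * indicator (A a) (X a x)) * iexp (SX \<theta> x)) =
        (CLINT x|N. of_real (pY x * indicator (A a) (Y a x)) * iexp (SY \<theta> x))"
      by (subst weighted_fourier_indicator[OF assms(1)], simp, simp, simp, simp, rule pX, rule pX,
          subst weighted_fourier_indicator[OF assms(2)], simp, simp, simp, simp, rule pY, rule pY)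
        (simp only: L L0)
    moreover have "pX x * indicator (A a) (X a x) = (\<Prod>i\<in>insert a F. indicator (A i) (X i x))" for x
      using insert.hyps by (simp add: pX_def)
    moreover have "pY x * indicator (A a) (Y a x) = (\<Prod>i\<in>insert a F. indicator (A i) (Y i x))" for x
      using insert.hyps by (simp add: pY_def)
    ultimately show ?case by (simp only: SX_def SY_def)
  qed
qed

text \<open>The case \<open>F = I\<close> at frequency 0, where the product of the indicators is the
  indicator of the rectangle event.\<close>

theorem fourier_rectangle_unique:
  fixes X :: "'i \<Rightarrow> 'a \<Rightarrow> real" and Y :: "'i \<Rightarrow> 'b \<Rightarrow> real"
  assumes "prob_space M" "prob_space N" "finite I"
    and X: "\<And>i. i \<in> I \<Longrightarrow> X i \<in> borel_measurable M"
    and Y: "\<And>i. i \<in> I \<Longrightarrow> Y i \<in> borel_measurable N"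
    and A: "\<And>i. i \<in> I \<Longrightarrow> A i \<in> sets borel"
    and eq: "\<And>\<theta>. (CLINT x|M. iexp (\<Sum>i\<in>I. \<theta> i * X i x)) = (CLINT x|N. iexp (\<Sum>i\<in>I. \<theta> i * Y i x))"
  shows "measure M {x \<in> space M. \<forall>i\<in>I. X i x \<in> A i} = measure N {x \<in> space N. \<forall>i\<in>I. Y i x \<in> A i}"
proof -
  have gen: "(CLINT x|L. of_real (\<Prod>i\<in>I. indicator (A i) (Z i x)) * iexp (\<Sum>i\<in>I. 0 * Z i x))
      = of_real (measure L {x \<in> space L. \<forall>i\<in>I. Z i x \<in> A i})"
    if "prob_space L" for L :: "'c measure" and Z
  proof -
    have "(CLINT x|L. of_real (\<Prod>i\<in>I. indicator (A i) (Z i x)) * iexp (\<Sum>i\<in>I. 0 * Z i x))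
        = (CLINT x|L. of_real (indicator {x \<in> space L. \<forall>i\<in>I. Z i x \<in> A i} x))"
    proof (intro Bochner_Integration.integral_cong refl)
      fix x assume "x \<in> space L"
      have "(\<Prod>i\<in>I. indicator (A i) (Z i x) :: real) = indicator {x \<in> space L. \<forall>i\<in>I. Z i x \<in> A i} x"
      proof (cases "\<forall>i\<in>I. Z i x \<in> A i")
        case True
        then have "(\<Prod>i\<in>I. indicator (A i) (Z i x) :: real) = (\<Prod>i\<in>I. 1)"
          by (intro prod.cong) auto
        then show ?thesis using True \<open>x \<in> space L\<close> by simp
      next
        case False
        then obtain i where "i \<in> I" "Z i x \<notin> A i" by blast
        then have "(\<Prod>i\<in>I. indicator (A i) (Z i x) :: real) = 0"
          by (intro prod_zero[OF \<open>finite I\<close>] bexI[of _ i]) auto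
        then show ?thesis using False by simp
      qed
      then show "of_real (\<Prod>i\<in>I. indicator (A i) (Z i x)) * iexp (\<Sum>i\<in>I. 0 * Z i x)
          = (of_real (indicator {x \<in> space L. \<forall>i\<in>I. Z i x \<in> A i} x) :: complex)"
        by (simp only:) simp
    qed
    also have "\<dots> = of_real (measure L {x \<in> space L. \<forall>i\<in>I. Z i x \<in> A i})"
    proof -
      have "{x \<in> space L. \<forall>i\<in>I. Z i x \<in> A i} \<inter> space L = {x \<in> space L. \<forall>i\<in>I. Z i x \<in> A i}"
        by blast
      then show ?thesis by (simp only: integral_complex_of_real Bochner_Integration.integral_indicator)
    qed
    finally show ?thesis .
  qed
  have "(of_real (measure M {x \<in> space M. \<forall>i\<in>I. X i x \<in> A i}) :: complex)
      = of_real (measure N {x \<in> space N. \<forall>i\<in>I. Y i x \<in> A i})"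
    unfolding gen[OF assms(1), of X, symmetric] gen[OF assms(2), of Y, symmetric]
    using assms by (intro rectangle_fourier) auto
  then show ?thesis by simp
qed

section \<open>Collision probabilities and coding\<close>

lemma sum_geometric_int_le:
  fixes r :: real
  assumes "0 \<le> r" "r \<le> 1 / 4" "finite J"
  shows "(\<Sum>j\<in>J. r ^ nat \<bar>j::int\<bar>) \<le> 1 + 4 * r"
proof -
  have r1: "r < 1" using assms by simp
  define n where "n = nat (Max (insert 0 (abs ` J)))"
  have sub: "J \<subseteq> {0} \<union> (int ` {1..n} \<union> (\<lambda>k. - int k) ` {1..n})"
  proof
    fix j assume "j \<in> J"
    then have "\<bar>j\<bar> \<le> Max (insert 0 (abs ` J))" using assms(3) by (intro Max_ge) auto
    then have "nat \<bar>j\<bar> \<le> n" by (simp add: n_def)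
    then consider "j = 0" | "j = int (nat \<bar>j\<bar>)" "nat \<bar>j\<bar> \<in> {1..n}" | "j = - int (nat \<bar>j\<bar>)" "nat \<bar>j\<bar> \<in> {1..n}"
      by (cases "j = 0"; cases "j > 0") auto
    then show "j \<in> {0} \<union> (int ` {1..n} \<union> (\<lambda>k. - int k) ` {1..n})"
      by cases blast+
  qed
  let ?g = "\<lambda>j::int. r ^ nat \<bar>j\<bar>"
  have geo: "(\<Sum>k\<in>{1..n}. r ^ k) \<le> r / (1 - r)"
  proof -
    have "(\<Sum>k\<in>{1..n}. r ^ k) = (\<Sum>k<n. r ^ Suc k)"
      by (rule sum.reindex_bij_witness[of _ Suc "\<lambda>k. k - 1"]) auto
    also have "\<dots> = r * (\<Sum>k<n. r ^ k)" by (simp add: sum_distrib_left)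
    also have "(\<Sum>k<n. r ^ k) = (1 - r ^ n) / (1 - r)"
      using r1 by (simp add: sum_gp_strict)
    also have "r * ((1 - r ^ n) / (1 - r)) \<le> r * (1 / (1 - r))"
      using assms r1 by (intro mult_left_mono divide_right_mono) auto
    finally show ?thesis by simp
  qed
  have un: "sum ?g (A \<union> B) \<le> sum ?g A + sum ?g B" if "finite A" "finite B" for A B
    using that assms by (subst sum_Un) (auto intro!: sum_nonneg)
  have "(\<Sum>j\<in>J. ?g j) \<le> sum ?g ({0} \<union> (int ` {1..n} \<union> (\<lambda>k. - int k) ` {1..n}))"
    using sub assms by (intro sum_mono2) auto
  also have "\<dots> \<le> sum ?g {0} + (sum ?g (int ` {1..n}) + sum ?g ((\<lambda>k. - int k) ` {1..n}))"
    by (intro order.trans[OF un] add_mono order.refl un) auto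
  also have "\<dots> = 1 + 2 * (\<Sum>k\<in>{1..n}. r ^ k)"
    by (simp add: sum.reindex inj_on_def)
  also have "\<dots> \<le> 1 + 2 * (r / (1 - r))" using geo by simp
  also have "r / (1 - r) \<le> 2 * r"
    using assms r1 mult_left_mono[of r "1/4" r] by (simp add: field_simps)
  finally show ?thesis by simp
qed

text \<open>The code length \<open>\<eta> + (ln (1 / \<eta>) + 2) * \<bar>j\<bar>\<close> charges only \<open>\<eta>\<close> for \<open>j = 0\<close>: on the fine levels
  almost all rounded increments vanish, and with \<open>\<eta>\<close> summable over the levels the total length stays
  bounded uniformly in the depth of the grid.\<close>

lemma kraft_sum_le_1:
  fixes \<eta> :: real
  assumes "0 < \<eta>" "\<eta> \<le> 1" "finite J"
  shows "(\<Sum>j\<in>J. exp (- (\<eta> + (ln (1 / \<eta>) + 2) * \<bar>real_of_int j\<bar>))) \<le> 1"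
proof -
  define r where "r = \<eta> * exp (- 2)"
  \<comment> \<open>This is what the summand 2 in the code length is for: it gives
    \<open>4 * r \<le> \<eta>\<close>, so the geometric sum is at most \<open>1 + \<eta>\<close>,
    hence at most \<open>exp \<eta>\<close>, which the factor \<open>exp (- \<eta>)\<close>
    cancels.\<close>
  have "4 * exp (-2 :: real) \<le> 1"
  proof -
    have "(2::real) * 2 \<le> exp 1 * exp 1"
      using exp_ge_add_one_self[of "1::real"] by (intro mult_mono) auto
    also have "\<dots> = exp (2::real)" by (simp flip: exp_add)
    finally have "4 / exp (2::real) \<le> 1" by simp
    then show ?thesis by (simp add: exp_minus divide_inverse)
  qed
  then have r: "0 \<le> r" "4 * r \<le> \<eta>"
    using assms by (auto simp: r_def mult.left_commute mult_left_le)
  have b: "exp (- (ln (1 / \<eta>) + 2)) = r"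
    using assms by (simp add: r_def exp_diff exp_minus ln_div field_simps)
  have "exp (- (\<eta> + (ln (1 / \<eta>) + 2) * \<bar>real_of_int j\<bar>)) = exp (- \<eta>) * r ^ nat \<bar>j\<bar>" for j
  proof -
    have "r ^ nat \<bar>j\<bar> = exp (real (nat \<bar>j\<bar>) * - (ln (1 / \<eta>) + 2))"
      unfolding b[symmetric] by (rule exp_of_nat_mult[symmetric])
    then show ?thesis by (simp add: mult_exp_exp algebra_simps)
  qed
  then have "(\<Sum>j\<in>J. exp (- (\<eta> + (ln (1 / \<eta>) + 2) * \<bar>real_of_int j\<bar>))) = exp (- \<eta>) * (\<Sum>j\<in>J. r ^ nat \<bar>j\<bar>)"
    by (simp add: sum_distrib_left)
  also have "\<dots> \<le> exp (- \<eta>) * (1 + \<eta>)"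
    using sum_geometric_int_le[of r J] r assms by (intro mult_left_mono) auto
  also have "\<dots> \<le> exp (- \<eta>) * exp \<eta>"
    by (intro mult_left_mono) (auto simp: exp_ge_add_one_self)
  finally show ?thesis by (simp add: mult_exp_exp)
qed

text \<open>Kraft's argument: every word of cost at most \<open>K\<close> contributes at least
  \<open>exp (- K)\<close> to a sum that factorises over the coordinates, and each factor is at most
  1.\<close>

lemma card_low_cost_codes:
  fixes \<eta> :: "'i \<Rightarrow> real" and K :: real
  assumes "finite I" and \<eta>: "\<And>i. i \<in> I \<Longrightarrow> 0 < \<eta> i \<and> \<eta> i \<le> 1"
  defines "S \<equiv> {f \<in> I \<rightarrow>\<^sub>E (UNIV :: int set). (\<Sum>i\<in>I. \<eta> i + (ln (1 / \<eta> i) + 2) * \<bar>real_of_int (f i)\<bar>) \<le> K}"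
  shows "finite S" "real (card S) \<le> exp K"
proof -
  \<comment> \<open>Only finite subsets can be counted at first; the uniform bound on them then
    yields finiteness of \<open>S\<close> itself.\<close>
  have bound: "real (card T) \<le> exp K" if "finite T" "T \<subseteq> S" for T
  proof -
    \<comment> \<open>Enlarging \<open>T\<close> to the box spanned by its coordinate projections
      lets the sum of products become a product of sums.\<close>
    define R where "R = (\<lambda>i. (\<lambda>f. f i) ` T)"
    have fR: "finite (R i)" for i using that by (simp add: R_def)
    have "real (card T) * exp (- K) = (\<Sum>f\<in>T. exp (- K))" by simp
    also have "\<dots> \<le> (\<Sum>f\<in>T. \<Prod>i\<in>I. exp (- (\<eta> i + (ln (1 / \<eta> i) + 2) * \<bar>real_of_int (f i)\<bar>)))"
    proof (rule sum_mono)
      fix f assume "f \<in> T"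
      then have "exp (- K) \<le> exp (- (\<Sum>i\<in>I. \<eta> i + (ln (1 / \<eta> i) + 2) * \<bar>real_of_int (f i)\<bar>))"
        using that by (auto simp: S_def)
      then show "exp (- K) \<le> (\<Prod>i\<in>I. exp (- (\<eta> i + (ln (1 / \<eta> i) + 2) * \<bar>real_of_int (f i)\<bar>)))"
        by (simp only: sum_negf[symmetric] exp_sum[OF \<open>finite I\<close>])
    qed
    also have "\<dots> \<le> (\<Sum>f\<in>PiE I R. \<Prod>i\<in>I. exp (- (\<eta> i + (ln (1 / \<eta> i) + 2) * \<bar>real_of_int (f i)\<bar>)))"
    proof (rule sum_mono2)
      show "finite (PiE I R)" by (intro finite_PiE \<open>finite I\<close> fR)
      show "T \<subseteq> PiE I R" using that by (auto simp: S_def R_def)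
    qed (auto intro!: prod_nonneg)
    also have "\<dots> = (\<Prod>i\<in>I. \<Sum>j\<in>R i. exp (- (\<eta> i + (ln (1 / \<eta> i) + 2) * \<bar>real_of_int j\<bar>)))"
      using fR \<open>finite I\<close> by (intro prod_sum_PiE[symmetric]) auto
    also have "\<dots> \<le> 1"
      using kraft_sum_le_1 \<eta> fR by (intro prod_le_1) (auto intro!: sum_nonneg)
    finally show ?thesis by (simp add: exp_minus field_simps)
  qed
  show "finite S"
  proof (rule ccontr)
    assume "infinite S"
    then obtain T where "T \<subseteq> S" "finite T" "card T = Suc (nat \<lceil>exp K\<rceil>)"
      using infinite_arbitrarily_large by blast
    with bound[of T] show False by linarith
  qed
  then show "real (card S) \<le> exp K" using bound by simp
qed

section \<open>Collisions of independent copies\<close>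

context prob_space
begin

text \<open>By Cauchy-Schwarz, \<open>card S\<close> times the sum of the squared probabilities is
  at least the square of their sum, and each squared probability is the chance that two independent
  samples both lie in the same \<open>E j\<close>.\<close>

lemma collision_prob_ge:
  assumes "finite S" and E: "\<And>j. j \<in> S \<Longrightarrow> E j \<in> events" and "disjoint_family_on E S"
    and C: "C \<in> sets (M \<Otimes>\<^sub>M M)" "\<And>j. j \<in> S \<Longrightarrow> E j \<times> E j \<subseteq> C"
  shows "(prob (\<Union>j\<in>S. E j))\<^sup>2 \<le> card S * measure (M \<Otimes>\<^sub>M M) C"
proof -
  interpret P: pair_prob_space M M ..
  have "(prob (\<Union>j\<in>S. E j))\<^sup>2 = (\<Sum>j\<in>S. prob (E j) * 1)\<^sup>2"
    using assms by (subst finite_measure_finite_Union) auto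
  also have "\<dots> \<le> (\<Sum>j\<in>S. (prob (E j))\<^sup>2) * (\<Sum>j\<in>S. 1\<^sup>2)"
    by (rule Cauchy_Schwarz_ineq_sum)
  also have "(\<Sum>j\<in>S. (prob (E j))\<^sup>2) = (\<Sum>j\<in>S. measure (M \<Otimes>\<^sub>M M) (E j \<times> E j))"
    using E by (intro sum.cong refl) (simp add: measure_def emeasure_pair_measure_Times enn2real_mult power2_eq_square)
  also have "\<dots> = measure (M \<Otimes>\<^sub>M M) (\<Union>j\<in>S. E j \<times> E j)"
    using assms(1,3) E
    by (intro P.finite_measure_finite_Union[symmetric]) (auto simp: disjoint_family_on_def)
  also have "\<dots> \<le> measure (M \<Otimes>\<^sub>M M) C"
    using C by (intro P.finite_measure_mono) auto
  finally show ?thesis by (simp add: mult.commute mult_right_mono)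
qed

text \<open>Markov's inequality puts the code length below \<open>2 * L\<close> with probability at
  least 1/2, and at most \<open>exp (2 * L)\<close> words are that short. The collision bound then
  gives a quarter divided by this number.\<close>

lemma coding_collision:
  fixes Z :: "'i \<Rightarrow> 'a \<Rightarrow> int" and \<eta> :: "'i \<Rightarrow> real"
  assumes "finite I" and \<eta>: "\<And>i. i \<in> I \<Longrightarrow> 0 < \<eta> i \<and> \<eta> i \<le> 1"
    and Z: "\<And>i. i \<in> I \<Longrightarrow> Z i \<in> measurable M (count_space UNIV)"
    and int: "\<And>i. i \<in> I \<Longrightarrow> integrable M (\<lambda>x. \<bar>real_of_int (Z i x)\<bar>)"
    and L: "(\<Sum>i\<in>I. \<eta> i + (ln (1 / \<eta> i) + 2) * expectation (\<lambda>x. \<bar>real_of_int (Z i x)\<bar>)) \<le> L" "0 < L"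
    and C: "C \<in> sets (M \<Otimes>\<^sub>M M)"
      "\<And>x y. x \<in> space M \<Longrightarrow> y \<in> space M \<Longrightarrow> (\<And>i. i \<in> I \<Longrightarrow> Z i x = Z i y) \<Longrightarrow> (x, y) \<in> C"
  shows "exp (- 2 * L) / 4 \<le> measure (M \<Otimes>\<^sub>M M) C"
proof -
  define cost where "cost x = (\<Sum>i\<in>I. \<eta> i + (ln (1 / \<eta> i) + 2) * \<bar>real_of_int (Z i x)\<bar>)" for x
  define S where "S = {f \<in> I \<rightarrow>\<^sub>E (UNIV :: int set). (\<Sum>i\<in>I. \<eta> i + (ln (1 / \<eta> i) + 2) * \<bar>real_of_int (f i)\<bar>) \<le> 2 * L}"
  define E where "E f = {x \<in> space M. \<forall>i\<in>I. Z i x = f i}" for f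
  have S: "finite S" "real (card S) \<le> exp (2 * L)"
    unfolding S_def using card_low_cost_codes[OF \<open>finite I\<close> \<eta>] by auto
  have [measurable]: "Z i \<in> measurable M (count_space UNIV)" if "i \<in> I" for i using Z that by auto
  have E: "E f \<in> events" for f
    unfolding E_def using \<open>finite I\<close> by measurable
  have disj: "disjoint_family_on E S"
  proof (unfold disjoint_family_on_def, intro ballI impI)
    fix f g assume "f \<in> S" "g \<in> S" "f \<noteq> g"
    then obtain i where i: "i \<in> I" "f i \<noteq> g i"
      unfolding S_def by (metis (mono_tags, lifting) PiE_ext mem_Collect_eq)
    have False if "x \<in> E f" "x \<in> E g" for x
    proof -
      have "Z i x = f i" "Z i x = g i" using that i by (auto simp: E_def)
      with i show False by simp
    qed
    then show "E f \<inter> E g = {}" by blast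
  qed
  have ln0: "0 \<le> ln (1 / \<eta> i) + 2" if "i \<in> I" for i
    using \<eta>[OF that] by (simp add: ln_div ln_le_zero_iff) (smt (verit) ln_le_zero_iff)
  have cost_int: "integrable M cost"
    unfolding cost_def using int by (intro Bochner_Integration.integrable_sum) auto
  have cost_E: "expectation cost \<le> L"
  proof -
    have "expectation cost = (\<Sum>i\<in>I. \<eta> i + (ln (1 / \<eta> i) + 2) * expectation (\<lambda>x. \<bar>real_of_int (Z i x)\<bar>))"
      unfolding cost_def using int by (subst Bochner_Integration.integral_sum) (auto simp: prob_space)
    with L show ?thesis by simp
  qed
  have cost0: "0 \<le> cost x" for x
    unfolding cost_def using ln0 \<eta> by (intro sum_nonneg) (auto intro!: add_nonneg_nonneg simp: less_imp_le)
  have low: "1 / 2 \<le> prob {x \<in> space M. cost x \<le> 2 * L}"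
  proof -
    have [measurable]: "cost \<in> borel_measurable M" using cost_int by auto
    have "prob {x \<in> space M. 2 * L \<le> cost x} \<le> expectation cost / (2 * L)"
      using cost_int cost0 L by (intro integral_Markov_inequality_measure[where A = "{}"]) auto
    also have "\<dots> \<le> 1 / 2" using cost_E L by (simp add: field_simps)
    finally have "prob {x \<in> space M. 2 * L \<le> cost x} \<le> 1 / 2" .
    moreover have "1 - prob {x \<in> space M. 2 * L \<le> cost x} = prob (space M - {x \<in> space M. 2 * L \<le> cost x})"
      by (rule prob_compl[symmetric]) measurable
    moreover have "prob (space M - {x \<in> space M. 2 * L \<le> cost x}) \<le> prob {x \<in> space M. cost x \<le> 2 * L}"
      by (intro finite_measure_mono) auto
    ultimately show ?thesis by linarith
  qed
  have "{x \<in> space M. cost x \<le> 2 * L} \<subseteq> (\<Union>f\<in>S. E f)"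
  proof
    fix x assume x: "x \<in> {x \<in> space M. cost x \<le> 2 * L}"
    then have "(\<lambda>i\<in>I. Z i x) \<in> S" "x \<in> E (\<lambda>i\<in>I. Z i x)"
      by (auto simp: S_def E_def cost_def cong: sum.cong)
    then show "x \<in> (\<Union>f\<in>S. E f)" by blast
  qed
  then have "prob {x \<in> space M. cost x \<le> 2 * L} \<le> prob (\<Union>f\<in>S. E f)"
    using S E by (intro finite_measure_mono) auto
  with low have "(1 / 2)\<^sup>2 \<le> (prob (\<Union>f\<in>S. E f))\<^sup>2" by (intro power_mono) auto
  also have "\<dots> \<le> card S * measure (M \<Otimes>\<^sub>M M) C"
    using S(1) E disj C(1)
  proof (rule collision_prob_ge)
    fix f assume "f \<in> S"
    show "E f \<times> E f \<subseteq> C" by (auto simp: E_def intro!: C(2))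
  qed
  also have "\<dots> \<le> exp (2 * L) * measure (M \<Otimes>\<^sub>M M) C"
    using S by (intro mult_right_mono) auto
  finally show ?thesis by (simp add: exp_minus field_simps power2_eq_square)
qed

text \<open>For an independent copy \<open>X'\<close>, the difference
  \<open>(X - X') / sqrt 2\<close> has the same Fourier transform as \<open>X\<close>: since
  \<open>q\<close> is homogeneous of degree 2, the two summands contribute a factor
  \<open>exp (- q \<theta> / 2)\<close> each. Rectangles are then compared by Fourier
  uniqueness.\<close>

lemma gaussian_symmetrization:
  fixes X :: "'i \<Rightarrow> 'a \<Rightarrow> real"
  assumes "finite F" and X: "\<And>t. t \<in> F \<Longrightarrow> random_variable borel (X t)"
    and char: "\<And>\<theta>. expectation (\<lambda>x. iexp (\<Sum>t\<in>F. \<theta> t * X t x)) = of_real (exp (- q \<theta>))"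
    and q: "\<And>r \<theta>. q (\<lambda>t. r * \<theta> t) = r\<^sup>2 * q \<theta>"
  shows "prob {x \<in> space M. \<forall>t\<in>F. \<bar>X t x\<bar> \<le> \<epsilon>} =
    measure (M \<Otimes>\<^sub>M M) {z \<in> space (M \<Otimes>\<^sub>M M). \<forall>t\<in>F. \<bar>X t (fst z) - X t (snd z)\<bar> \<le> sqrt 2 * \<epsilon>}"
proof -
  interpret P: pair_prob_space M M ..
  have [measurable]: "X t \<in> borel_measurable M" if "t \<in> F" for t using X that by auto
  define Y where "Y t z = (X t (fst z) - X t (snd z)) / sqrt 2" for t and z :: "'a \<times> 'a"
  have Y[measurable]: "Y t \<in> borel_measurable (M \<Otimes>\<^sub>M M)" if "t \<in> F" for t
    unfolding Y_def using that by measurable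
  have eq: "expectation (\<lambda>x. iexp (\<Sum>t\<in>F. \<theta> t * X t x)) = (CLINT z|M \<Otimes>\<^sub>M M. iexp (\<Sum>t\<in>F. \<theta> t * Y t z))" for \<theta>
  proof -
    define r where "r = 1 / sqrt (2::real)"
    define f g where "f x = iexp (\<Sum>t\<in>F. (r * \<theta> t) * X t x)" and "g x = iexp (\<Sum>t\<in>F. (- r * \<theta> t) * X t x)" for x
    have [measurable]: "f \<in> borel_measurable M" "g \<in> borel_measurable M"
      unfolding f_def g_def by measurable
    have fg: "iexp (\<Sum>t\<in>F. \<theta> t * Y t (x, y)) = f x * g y" for x y
    proof -
      have "(\<Sum>t\<in>F. \<theta> t * Y t (x, y)) = (\<Sum>t\<in>F. (r * \<theta> t) * X t x) + (\<Sum>t\<in>F. (- r * \<theta> t) * X t y)"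
        unfolding sum.distrib[symmetric]
        by (intro sum.cong) (simp_all add: Y_def r_def diff_divide_distrib right_diff_distrib)
      then show ?thesis by (simp only: f_def g_def of_real_add distrib_left exp_add)
    qed
    have "integrable (M \<Otimes>\<^sub>M M) (\<lambda>z. iexp (\<Sum>t\<in>F. \<theta> t * Y t z))"
      by (rule P.integrable_const_bound[where B = 1]) auto
    then have "(CLINT z|M \<Otimes>\<^sub>M M. iexp (\<Sum>t\<in>F. \<theta> t * Y t z)) = (CLINT x|M. CLINT y|M. iexp (\<Sum>t\<in>F. \<theta> t * Y t (x, y)))"
      by (rule P.integral_fst'[symmetric])
    also have "\<dots> = (CLINT x|M. f x) * (CLINT y|M. g y)"
      unfolding fg by simp
    also have "\<dots> = of_real (exp (- (r\<^sup>2 * q \<theta>)) * exp (- ((- r)\<^sup>2 * q \<theta>)))"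
      unfolding f_def g_def char q of_real_mult ..
    also have "\<dots> = of_real (exp (- q \<theta>))"
      by (simp add: mult_exp_exp r_def power_divide)
    finally show ?thesis unfolding char by simp
  qed
  have "prob {x \<in> space M. \<forall>t\<in>F. X t x \<in> {-\<epsilon>..\<epsilon>}} =
      measure (M \<Otimes>\<^sub>M M) {z \<in> space (M \<Otimes>\<^sub>M M). \<forall>t\<in>F. Y t z \<in> {-\<epsilon>..\<epsilon>}}"
    by (rule fourier_rectangle_unique) (use assms Y eq in \<open>auto intro: prob_space_axioms P.prob_space_axioms\<close>)
  moreover have "Y t z \<in> {-\<epsilon>..\<epsilon>} \<longleftrightarrow> \<bar>X t (fst z) - X t (snd z)\<bar> \<le> sqrt 2 * \<epsilon>" for t z
    by (auto simp: Y_def field_simps abs_le_iff)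
  moreover have "X t x \<in> {-\<epsilon>..\<epsilon>} \<longleftrightarrow> \<bar>X t x\<bar> \<le> \<epsilon>" for t x
    by auto
  ultimately show ?thesis by (simp only:)
qed

end

section \<open>Chaining on dyadic grids\<close>

text \<open>Level \<open>0\<close> stores the increments of the rounded values rather than the rounded increments,
  since otherwise the rounding errors would add up along the \<open>N\<close> grid points. For \<open>m \<ge> 1\<close> the index
  \<open>(m, k)\<close> stands for the odd grid point \<open>2 k + 1\<close> of level \<open>m\<close> and its left neighbour, a point of
  level \<open>m - 1\<close>.\<close>

definition quantized_increment :: "real \<Rightarrow> (nat \<Rightarrow> real) \<Rightarrow> (real \<Rightarrow> real) \<Rightarrow> nat \<times> nat \<Rightarrow> int" where
  "quantized_increment \<delta> h x = (\<lambda>(m, k).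
    if m = 0 then round (x (real (Suc k) * \<delta>) / h 0) - round (x (real k * \<delta>) / h 0)
    else round ((x (real (2 * k + 1) * \<delta> / 2 ^ m) - x (real (2 * k) * \<delta> / 2 ^ m)) / h m))"

definition chaining_index :: "nat \<Rightarrow> nat \<Rightarrow> (nat \<times> nat) set" where
  "chaining_index N R = (SIGMA m:{..R}. {..<(if m = 0 then N else N * 2 ^ (m - 1))})"

lemma same_round_dist:
  fixes a b h :: real
  assumes "0 < h" "round (a / h) = round (b / h)"
  shows "\<bar>a - b\<bar> \<le> h"
proof -
  have "\<bar>a / h - b / h\<bar> \<le> 1"
    using of_int_round_abs_le[of "a / h"] of_int_round_abs_le[of "b / h"] assms(2) by linarith
  then have "\<bar>(a - b) / h\<bar> \<le> 1" by (simp add: diff_divide_distrib)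
  then show ?thesis using assms(1) by (simp add: abs_divide)
qed

text \<open>Induction over the levels: an even point of level \<open>Suc m\<close> already belongs
  to level \<open>m\<close>, and at an odd point the increment from the left neighbour is known up
  to \<open>h (Suc m)\<close>. So errors add up over the levels but never along the grid.\<close>

lemma same_quantization_dist:
  fixes x y :: "real \<Rightarrow> real"
  assumes h: "\<And>m. 0 < h m" and "x 0 = y 0"
    and eq: "\<And>i. i \<in> chaining_index N R \<Longrightarrow> quantized_increment \<delta> h x i = quantized_increment \<delta> h y i"
  shows "m \<le> R \<Longrightarrow> k \<le> N * 2 ^ m \<Longrightarrow>
    \<bar>x (real k * \<delta> / 2 ^ m) - y (real k * \<delta> / 2 ^ m)\<bar> \<le> (\<Sum>j\<le>m. h j)"
proof (induction m arbitrary: k)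
  case 0
  \<comment> \<open>On level 0 equal integer increments add up, from the common value at 0, to equal
    rounded values.\<close>
  have "k \<le> N \<Longrightarrow> round (x (real k * \<delta>) / h 0) = round (y (real k * \<delta>) / h 0)" for k
  proof (induction k)
    case (Suc k)
    then show ?case
      using eq[of "(0, k)"] by (auto simp: chaining_index_def quantized_increment_def)
  qed (simp add: assms)
  with 0 show ?case using same_round_dist[OF h[of 0]] by simp
next
  case (Suc m)
  have even: "\<bar>x (real (2 * j) * \<delta> / 2 ^ Suc m) - y (real (2 * j) * \<delta> / 2 ^ Suc m)\<bar> \<le> (\<Sum>j\<le>m. h j)"
    if "j \<le> N * 2 ^ m" for j
    using Suc.IH[of j] Suc.prems that by simp
  show ?case
  proof (cases "even k")
    case True
    then obtain j where "k = 2 * j" by blast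
    then show ?thesis using even[of j] Suc.prems h[of "Suc m"] by simp
  next
    case False
    then obtain j where k: "k = 2 * j + 1" by (rule oddE)
    with Suc.prems have j: "j < N * 2 ^ m" by simp
    let ?d = "\<lambda>z. z (real (2 * j + 1) * \<delta> / 2 ^ Suc m) - z (real (2 * j) * \<delta> / 2 ^ Suc m) :: real"
    have "round (?d x / h (Suc m)) = round (?d y / h (Suc m))"
      using eq[of "(Suc m, j)"] j Suc.prems by (simp add: chaining_index_def quantized_increment_def)
    then have "\<bar>?d x - ?d y\<bar> \<le> h (Suc m)" using same_round_dist h by blast
    with even[of j] j show ?thesis unfolding k by (simp add: abs_le_iff)
  qed
qed

text \<open>A nonzero rounded value forces \<open>2 * \<bar>a\<bar> \<ge> 1\<close>, so raising to a
  power only increases the bound. The absence of an additive constant makes the expected codes on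
  fine levels small.\<close>

lemma abs_round_le_power:
  fixes a :: real
  assumes "1 \<le> p"
  shows "\<bar>real_of_int (round a)\<bar> \<le> (2 * \<bar>a\<bar>) ^ p"
proof (cases "round a = 0")
  case False
  then have "1 \<le> \<bar>real_of_int (round a)\<bar>" by linarith
  moreover have "\<bar>real_of_int (round a) - a\<bar> \<le> 1 / 2" by (rule of_int_round_abs_le)
  ultimately have "\<bar>real_of_int (round a)\<bar> \<le> 2 * \<bar>a\<bar>" "1 \<le> 2 * \<bar>a\<bar>" by linarith+
  then show ?thesis using self_le_power[of "2 * \<bar>a\<bar>" p] assms by linarith
qed simp

lemma abs_le_one_plus_power:
  fixes a :: real
  assumes "1 \<le> p"
  shows "\<bar>a\<bar> \<le> 1 + \<bar>a\<bar> ^ p"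
proof (cases "\<bar>a\<bar> \<le> 1")
  case False
  then have "\<bar>a\<bar> \<le> \<bar>a\<bar> ^ p" using assms by (intro self_le_power) auto
  then show ?thesis by simp
qed (simp add: add_increasing2)

section \<open>Expected code lengths and small balls on a grid\<close>

context prob_space
begin

lemma quantized_increment_measurable:
  assumes "\<And>t. 0 \<le> t \<Longrightarrow> random_variable borel (X t)" "0 \<le> \<delta>"
  shows "(\<lambda>\<omega>. quantized_increment \<delta> h (\<lambda>t. X t \<omega>) i) \<in> measurable M (count_space UNIV)"
proof -
  have [measurable]: "X (real k * \<delta>) \<in> borel_measurable M" "X (real k * \<delta> / 2 ^ m) \<in> borel_measurable M" for k m
    using assms by auto
  have [measurable]: "(round :: real \<Rightarrow> int) \<in> measurable borel (count_space UNIV)"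
    unfolding round_def by measurable
  show ?thesis
    unfolding quantized_increment_def by (cases i) (simp split: prod.split del: of_nat_Suc of_nat_add of_nat_mult)
qed

text \<open>Up to constants, the increments on level \<open>m\<close> have size
  \<open>\<epsilon> * 2 powr (- m * H)\<close> in the \<open>p\<close>-th mean, whereas the
  precision decreases only like \<open>\<epsilon> * 2 powr (- m * H / 2)\<close>. The
  \<open>p\<close>-th power of the ratio is at most of order \<open>1 / 8 ^ m\<close> because
  \<open>H * p \<ge> 6\<close>.\<close>

lemma quantized_increment_moment:
  fixes X :: "real \<Rightarrow> 'a \<Rightarrow> real" and \<delta> H K c \<epsilon> :: real
  assumes X: "\<And>t. 0 \<le> t \<Longrightarrow> random_variable borel (X t)"
    and mom: "\<And>s t. s \<in> {0..T} \<Longrightarrow> t \<in> {0..T} \<Longrightarrow> integrable M (\<lambda>\<omega>. \<bar>X s \<omega> - X t \<omega>\<bar> ^ p) \<and>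
        expectation (\<lambda>\<omega>. \<bar>X s \<omega> - X t \<omega>\<bar> ^ p) \<le> K * \<bar>s - t\<bar> powr (H * p)"
    and p: "1 \<le> p" "6 \<le> H * p" and "0 < \<delta>" "0 < c" "0 \<le> K" "0 < \<epsilon>" "\<delta> powr H \<le> \<epsilon>"
    and T: "T = real N * \<delta>" and i: "(m, k) \<in> chaining_index N R"
    and h: "\<And>m. h m = c * \<epsilon> * (2 powr (- H / 2)) ^ m"
  shows "integrable M (\<lambda>\<omega>. \<bar>real_of_int (quantized_increment \<delta> h (\<lambda>t. X t \<omega>) (m, k))\<bar>)" (is ?A)
    and "expectation (\<lambda>\<omega>. \<bar>real_of_int (quantized_increment \<delta> h (\<lambda>t. X t \<omega>) (m, k))\<bar>)
      \<le> (if m = 0 then 2 else 0) + (2 / c) ^ p * K / 8 ^ m" (is ?B)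
proof -
  have hpos: "0 < h m" for m using \<open>0 < c\<close> \<open>0 < \<epsilon>\<close> by (simp add: h)
  define Q where "Q \<omega> = \<bar>real_of_int (quantized_increment \<delta> h (\<lambda>t. X t \<omega>) (m, k))\<bar>" for \<omega>
  define s where "s = (if m = 0 then real (Suc k) * \<delta> else real (2 * k + 1) * \<delta> / 2 ^ m)"
  define t where "t = (if m = 0 then real k * \<delta> else real (2 * k) * \<delta> / 2 ^ m)"
  \<comment> \<open>On level 0 a difference of two rounded values exceeds the scaled increment by at
    most 1, and another 1 comes from
    \<open>\<bar>a\<bar> \<le> 1 + \<bar>a\<bar> ^ p\<close>.\<close>
  define w where "w = (if m = 0 then 2 else 0 :: real)"
  have st: "s \<in> {0..T}" "t \<in> {0..T}" "\<bar>s - t\<bar> = \<delta> / 2 ^ m"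
  proof -
    have *: "real a * \<delta> / 2 ^ m \<in> {0..T}" if "a \<le> N * 2 ^ m" for a
    proof -
      have "real a \<le> real N * 2 ^ m" using that by (metis of_nat_le_iff of_nat_mult of_nat_numeral of_nat_power)
      then have "real a * \<delta> \<le> (real N * 2 ^ m) * \<delta>" using \<open>0 < \<delta>\<close> by (intro mult_right_mono) auto
      then have "real a * \<delta> / 2 ^ m \<le> T" by (simp add: T pos_divide_le_eq mult_ac)
      then show ?thesis using \<open>0 < \<delta>\<close> by simp
    qed
    have k: "if m = 0 then k < N else 2 * k + 1 \<le> N * 2 ^ m"
      using i by (cases m) (auto simp: chaining_index_def)
    show "s \<in> {0..T}" "t \<in> {0..T}"
      using k *[of "Suc k"] *[of k] *[of "2 * k + 1"] *[of "2 * k"] by (auto simp: s_def t_def split: if_splits)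
    show "\<bar>s - t\<bar> = \<delta> / 2 ^ m"
      using \<open>0 < \<delta>\<close> by (simp add: s_def t_def field_simps)
  qed
  have Q_le: "Q \<omega> \<le> w + (2 / h m) ^ p * \<bar>X s \<omega> - X t \<omega>\<bar> ^ p" for \<omega>
  proof -
    define a where "a = (X s \<omega> - X t \<omega>) / h m"
    have a: "\<bar>a\<bar> ^ p = \<bar>X s \<omega> - X t \<omega>\<bar> ^ p / h m ^ p"
      using hpos[of m] by (simp add: a_def power_divide)
    have "Q \<omega> \<le> w + (2 * \<bar>a\<bar>) ^ p"
    proof (cases "m = 0")
      case True
      have "Q \<omega> \<le> \<bar>a\<bar> + 1"
      proof -
        have "X s \<omega> / h 0 - X t \<omega> / h 0 = a" using True by (simp add: a_def diff_divide_distrib)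
        moreover have "Q \<omega> = \<bar>real_of_int (round (X s \<omega> / h 0)) - real_of_int (round (X t \<omega> / h 0))\<bar>"
          using True by (simp add: Q_def quantized_increment_def s_def t_def)
        ultimately show ?thesis
          using of_int_round_abs_le[of "X s \<omega> / h 0"] of_int_round_abs_le[of "X t \<omega> / h 0"] by linarith
      qed
      also have "\<bar>a\<bar> \<le> 1 + \<bar>a\<bar> ^ p" using p by (intro abs_le_one_plus_power)
      also have "\<bar>a\<bar> ^ p \<le> (2 * \<bar>a\<bar>) ^ p" by (intro power_mono) auto
      finally show ?thesis using True by (simp add: w_def)
    next
      case False
      then have "Q \<omega> = \<bar>real_of_int (round a)\<bar>"
        by (simp add: Q_def quantized_increment_def s_def t_def a_def)
      then show ?thesis using abs_round_le_power[OF p(1), of a] False by (simp add: w_def)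
    qed
    then show ?thesis by (simp add: power_mult_distrib a power_divide)
  qed
  have int: "integrable M (\<lambda>\<omega>. w + (2 / h m) ^ p * \<bar>X s \<omega> - X t \<omega>\<bar> ^ p)"
    using mom[OF st(1,2)] by auto
  have [measurable]: "(\<lambda>\<omega>. quantized_increment \<delta> h (\<lambda>t. X t \<omega>) (m, k)) \<in> measurable M (count_space UNIV)"
    using X \<open>0 < \<delta>\<close> by (intro quantized_increment_measurable) auto
  have Qm: "Q \<in> borel_measurable M" unfolding Q_def by measurable
  have Qint: "integrable M Q"
    by (rule Bochner_Integration.integrable_bound[OF int Qm]) (use Q_le in \<open>auto simp: Q_def intro: order.trans[OF _ abs_ge_self]\<close>)
  then show ?A unfolding Q_def .
  have "expectation Q \<le> expectation (\<lambda>\<omega>. w + (2 / h m) ^ p * \<bar>X s \<omega> - X t \<omega>\<bar> ^ p)"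
    using Q_le by (intro integral_mono Qint int)
  also have "\<dots> = w + (2 / h m) ^ p * expectation (\<lambda>\<omega>. \<bar>X s \<omega> - X t \<omega>\<bar> ^ p)"
    using mom[OF st(1,2)] by (simp add: prob_space)
  also have "\<dots> \<le> w + (2 / h m) ^ p * (K * (\<delta> / 2 ^ m) powr (H * p))"
    using mom[OF st(1,2)] hpos[of m] unfolding st(3) by (intro add_left_mono mult_left_mono) auto
  also have "(2 / h m) ^ p * (K * (\<delta> / 2 ^ m) powr (H * p)) \<le> (2 / c) ^ p * K / 8 ^ m"
  proof -
    \<comment> \<open>The increment scale supplies \<open>\<rho> ^ m\<close> twice; one factor
      cancels against \<open>h m\<close>, the other remains as decay.\<close>
    define \<rho> where "\<rho> = 2 powr (- H / 2)"
    have \<rho>: "0 < \<rho>" by (simp add: \<rho>_def)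
    have "(\<delta> / 2 ^ m) powr (H * p) = ((\<delta> / 2 ^ m) powr H) ^ p"
      using \<open>0 < \<delta>\<close> by (simp add: powr_powr[of _ H, symmetric] powr_realpow)
    also have "(\<delta> / 2 ^ m) powr H = \<delta> powr H * (\<rho> ^ m * \<rho> ^ m)"
    proof -
      have "\<rho> * \<rho> = 2 powr (- H)"
        unfolding \<rho>_def by (subst powr_add[symmetric]) simp
      then have "\<rho> ^ m * \<rho> ^ m = (2 powr (- H)) ^ m"
        by (metis power_mult_distrib)
      also have "\<dots> = 1 / (2 powr H) ^ m" by (simp add: powr_minus power_inverse divide_inverse)
      also have "(2 powr H) ^ m = (2 ^ m) powr H"
        by (subst (1 2) powr_realpow[symmetric]) (simp_all only: powr_powr mult.commute, simp_all)
      finally have "\<rho> ^ m * \<rho> ^ m = 1 / (2 ^ m) powr H" .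
      then show ?thesis using \<open>0 < \<delta>\<close> by (simp add: powr_divide)
    qed
    also have "(\<delta> powr H * (\<rho> ^ m * \<rho> ^ m)) ^ p \<le> (\<epsilon> * (\<rho> ^ m * \<rho> ^ m)) ^ p"
      using \<open>\<delta> powr H \<le> \<epsilon>\<close> \<rho> by (intro power_mono mult_right_mono) auto
    finally have "(2 / h m) ^ p * (K * (\<delta> / 2 ^ m) powr (H * p)) \<le> (2 / h m) ^ p * (K * (\<epsilon> * (\<rho> ^ m * \<rho> ^ m)) ^ p)"
      using hpos[of m] \<open>0 \<le> K\<close> by (intro mult_left_mono) auto
    also have "\<dots> = K * ((2 / h m) * (\<epsilon> * (\<rho> ^ m * \<rho> ^ m))) ^ p"
      by (simp add: power_mult_distrib power_divide)
    also have "(2 / h m) * (\<epsilon> * (\<rho> ^ m * \<rho> ^ m)) = (2 / c) * \<rho> ^ m"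
      using \<open>0 < c\<close> \<open>0 < \<epsilon>\<close> \<rho> unfolding h \<rho>_def[symmetric] by (simp add: divide_simps)
    also have "K * (2 / c * \<rho> ^ m) ^ p = (2 / c) ^ p * K * (\<rho> ^ p) ^ m"
    proof -
      have "(\<rho> ^ m) ^ p = (\<rho> ^ p) ^ m" by (metis power_mult mult.commute)
      then show ?thesis by (simp add: power_mult_distrib power_divide)
    qed
    also have "\<dots> \<le> (2 / c) ^ p * K * (1 / 8) ^ m"
    proof -
      have "\<rho> ^ p = 2 powr (- H / 2 * p)"
        unfolding \<rho>_def by (subst powr_powr[symmetric]) (simp add: powr_realpow)
      also have "\<dots> \<le> 2 powr (- 3)" using p by (intro powr_mono) (auto simp: field_simps)
      also have "\<dots> = 1 / 8" by (simp add: powr_minus powr_numeral)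
      finally show ?thesis using \<open>0 < c\<close> \<open>0 \<le> K\<close> \<rho> by (intro mult_left_mono power_mono) auto
    qed
    finally show ?thesis by (simp add: power_divide)
  qed
  finally show ?B unfolding Q_def w_def by simp
qed


text \<open>Level \<open>m \<ge> 1\<close> carries \<open>N * 2 ^ (m - 1)\<close> codes, each of
  expected length of order \<open>1 / 4 ^ m\<close>, so the total is of order \<open>N\<close>
  whatever the depth \<open>R\<close>. Agreeing codes force two independent copies to be within
  \<open>\<epsilon>\<close> on the grid, which symmetrization turns into a small ball.\<close>

lemma grid_small_ball_ge:
  fixes X :: "real \<Rightarrow> 'a \<Rightarrow> real" and \<delta> H K \<epsilon> :: real
  assumes X: "\<And>t. 0 \<le> t \<Longrightarrow> random_variable borel (X t)"
    and X0: "\<And>\<omega>. \<omega> \<in> space M \<Longrightarrow> X 0 \<omega> = 0"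
    and char: "\<And>u n \<theta>. 0 < u \<Longrightarrow>
        expectation (\<lambda>\<omega>. iexp (\<Sum>k\<le>n. \<theta> k * X (real k * u) \<omega>)) = of_real (exp (- q u n \<theta>))"
    and q: "\<And>u n r \<theta>. q u n (\<lambda>k. r * \<theta> k) = r\<^sup>2 * q u n \<theta>"
    and mom: "\<And>s t. s \<in> {0..T} \<Longrightarrow> t \<in> {0..T} \<Longrightarrow> integrable M (\<lambda>\<omega>. \<bar>X s \<omega> - X t \<omega>\<bar> ^ p) \<and>
        expectation (\<lambda>\<omega>. \<bar>X s \<omega> - X t \<omega>\<bar> ^ p) \<le> K * \<bar>s - t\<bar> powr (H * p)"
    and p: "1 \<le> p" "6 \<le> H * p" and "0 < \<delta>" "0 \<le> K" "0 < \<epsilon>" "\<delta> powr H \<le> \<epsilon>" "0 < H"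
    and T: "T = real N * \<delta>" "0 < N"
  defines "A \<equiv> (2 / (1 - 2 powr (- H / 2))) ^ p * K"
  shows "exp (- real N * (20 + 12 * A)) / 4 \<le>
    prob {\<omega> \<in> space M. \<forall>t\<in>(\<lambda>k. real k * \<delta> / 2 ^ R) ` {..N * 2 ^ R}. \<bar>X t \<omega>\<bar> \<le> \<epsilon>}"
proof -
  define \<rho> where "\<rho> = 2 powr (- H / 2)"
  \<comment> \<open>Normalises the geometric series: the precisions \<open>h m\<close> of all levels
    sum to at most \<open>\<epsilon>\<close>.\<close>
  define c where "c = 1 - \<rho>"
  have \<rho>: "0 < \<rho>" "\<rho> < 1" using \<open>0 < H\<close> by (auto simp: \<rho>_def intro: powr_less_one)
  have c: "0 < c" using \<rho> by (simp add: c_def)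
  define h where "h m = c * \<epsilon> * \<rho> ^ m" for m
  have hpos: "0 < h m" for m using c \<rho> \<open>0 < \<epsilon>\<close> by (simp add: h_def)
  have hsum: "(\<Sum>j\<le>m. h j) \<le> \<epsilon>" for m
  proof -
    have "(\<Sum>j\<le>m. h j) = \<epsilon> * (c * (\<Sum>j<Suc m. \<rho> ^ j))"
      by (simp add: h_def sum_distrib_left lessThan_Suc_atMost mult_ac del: sum.lessThan_Suc)
    also have "c * (\<Sum>j<Suc m. \<rho> ^ j) = 1 - \<rho> ^ Suc m"
      unfolding c_def by (rule one_diff_power_eq[symmetric])
    also have "\<epsilon> * (1 - \<rho> ^ Suc m) \<le> \<epsilon>" using \<rho> \<open>0 < \<epsilon>\<close> by (simp add: mult_left_le)
    finally show ?thesis .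
  qed
  have A: "0 \<le> A" "A = (2 / c) ^ p * K"
    using c \<open>0 \<le> K\<close> by (auto simp: A_def c_def \<rho>_def)
  define I where "I = chaining_index N R"
  define F where "F = (\<lambda>k. real k * \<delta> / 2 ^ R) ` {..N * 2 ^ R}"
  define Z where "Z i \<omega> = quantized_increment \<delta> h (\<lambda>t. X t \<omega>) i" for i \<omega>
  \<comment> \<open>Decay faster than the doubling of the number of grid points keeps the cost of
    vanishing codes summable, while \<open>ln (1 / \<eta> i)\<close> grows only linearly in the
    level.\<close>
  define \<eta> where "\<eta> i = (1 / 4 :: real) ^ fst i" for i :: "nat \<times> nat"
  have F: "finite F" "F \<subseteq> {0..}" using \<open>0 < \<delta>\<close> by (auto simp: F_def)
  have I: "finite I" unfolding I_def chaining_index_def by auto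
  have \<eta>: "0 < \<eta> i \<and> \<eta> i \<le> 1" for i by (auto simp: \<eta>_def power_le_one)
  have Zint: "integrable M (\<lambda>x. \<bar>real_of_int (Z i x)\<bar>)"
    and ZE: "expectation (\<lambda>x. \<bar>real_of_int (Z i x)\<bar>) \<le> (if fst i = 0 then 2 else 0) + A / 8 ^ fst i"
    if "i \<in> I" for i
  proof -
    obtain m k where i: "i = (m, k)" by (cases i)
    have h': "h m = c * \<epsilon> * (2 powr (- H / 2)) ^ m" for m by (simp add: h_def \<rho>_def)
    have mk: "(m, k) \<in> chaining_index N R" using that by (simp add: i I_def)
    show "integrable M (\<lambda>x. \<bar>real_of_int (Z i x)\<bar>)"
      unfolding Z_def i
      by (rule quantized_increment_moment(1)[OF X mom p \<open>0 < \<delta>\<close> c \<open>0 \<le> K\<close> \<open>0 < \<epsilon>\<close> \<open>\<delta> powr H \<le> \<epsilon>\<close> T(1) mk h'])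
    show "expectation (\<lambda>x. \<bar>real_of_int (Z i x)\<bar>) \<le> (if fst i = 0 then 2 else 0) + A / 8 ^ fst i"
      unfolding Z_def i A(2) fst_conv
      by (rule quantized_increment_moment(2)[OF X mom p \<open>0 < \<delta>\<close> c \<open>0 \<le> K\<close> \<open>0 < \<epsilon>\<close> \<open>\<delta> powr H \<le> \<epsilon>\<close> T(1) mk h'])
  qed
  define w where "w m = (1 / 4 :: real) ^ m + 2 * 2 ^ m * ((if m = 0 then 2 else 0) + A / 8 ^ m)" for m
  have cost: "\<eta> i + (ln (1 / \<eta> i) + 2) * expectation (\<lambda>x. \<bar>real_of_int (Z i x)\<bar>) \<le> w (fst i)"
    if "i \<in> I" for i
  proof -
    define m where "m = fst i"
    have "ln (1 / \<eta> i) = real m * ln 4" by (simp add: \<eta>_def m_def ln_realpow power_divide)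
    moreover have "ln (4::real) \<le> 2"
      using ln_2_less_1 ln_mult[of "2::real" 2] by simp
    ultimately have "ln (1 / \<eta> i) + 2 \<le> 2 * (real m + 1)"
      using mult_left_mono[of "ln 4" 2 "real m"] by simp
    also have "real m + 1 \<le> 2 ^ m" using self_le_ge2_pow[of 2 m] less_exp[of m]
      by (metis Suc_leI add.commute of_nat_Suc of_nat_le_iff of_nat_numeral of_nat_power)
    finally have "ln (1 / \<eta> i) + 2 \<le> 2 * 2 ^ m" by simp
    then have "(ln (1 / \<eta> i) + 2) * expectation (\<lambda>x. \<bar>real_of_int (Z i x)\<bar>)
        \<le> 2 * 2 ^ m * ((if m = 0 then 2 else 0) + A / 8 ^ m)"
      using ZE[OF that] by (intro mult_mono) (auto simp: m_def)
    then show ?thesis by (simp add: w_def \<eta>_def m_def)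
  qed
  \<comment> \<open>Twice \<open>N * (5 + 3 * A)\<close>: the cost of level \<open>m\<close> is at
    most this product times \<open>(1 / 2) ^ m\<close>, a geometric series of sum at most 2.\<close>
  define L where "L = real N * (10 + 6 * A)"
  have "(\<Sum>i\<in>I. \<eta> i + (ln (1 / \<eta> i) + 2) * expectation (\<lambda>x. \<bar>real_of_int (Z i x)\<bar>)) \<le> (\<Sum>i\<in>I. w (fst i))"
    by (intro sum_mono cost)
  also have "\<dots> = (\<Sum>m\<le>R. real (if m = 0 then N else N * 2 ^ (m - 1)) * w m)"
  proof -
    have "(\<Sum>i\<in>I. w (fst i)) = (\<Sum>m\<le>R. \<Sum>k<(if m = 0 then N else N * 2 ^ (m - 1)). w m)"
      unfolding I_def chaining_index_def by (subst sum.Sigma) (auto simp: case_prod_unfold)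
    then show ?thesis by simp
  qed
  also have "\<dots> \<le> (\<Sum>m\<le>R. real N * (5 + 3 * A) * (1 / 2) ^ m)"
  proof (intro sum_mono)
    fix m
    show "real (if m = 0 then N else N * 2 ^ (m - 1)) * w m \<le> real N * (5 + 3 * A) * (1 / 2) ^ m"
    proof (cases m)
      case 0
      have "w m \<le> 5 + 3 * A" using A(1) 0 by (simp add: w_def)
      then show ?thesis using 0 mult_left_mono[of "w m" "5 + 3 * A" "real N"] by simp
    next
      case (Suc n)
      have e: "(4::real) ^ n = 2 ^ n * 2 ^ n" "(8::real) ^ n = 2 ^ n * 2 ^ n * 2 ^ n"
        by (simp_all flip: power_mult_distrib)
      have "2 ^ n * w m = (1 / 2) ^ n * (1 / 4 + A / 2)"
        unfolding w_def Suc by (simp add: power_divide e field_simps)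
      also have "\<dots> \<le> (1 / 2) ^ n * ((5 + 3 * A) / 2)"
        using A(1) by (intro mult_left_mono) auto
      finally have "real N * (2 ^ n * w m) \<le> real N * ((1 / 2) ^ n * ((5 + 3 * A) / 2))"
        by (intro mult_left_mono) auto
      then show ?thesis by (simp add: Suc mult_ac)
    qed
  qed
  also have "\<dots> \<le> L"
  proof -
    have "(\<Sum>m\<le>R. (1 / 2 :: real) ^ m) \<le> 2"
      using sum_gp_basic[of "1 / 2 :: real" R] by simp
    then have "real N * (5 + 3 * A) * (\<Sum>m\<le>R. (1 / 2 :: real) ^ m) \<le> real N * (5 + 3 * A) * 2"
      using A(1) by (intro mult_left_mono) auto
    moreover have "real N * (5 + 3 * A) * 2 = L" by (simp add: L_def algebra_simps)
    ultimately show ?thesis by (simp only: sum_distrib_left)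
  qed
  finally have costL: "(\<Sum>i\<in>I. \<eta> i + (ln (1 / \<eta> i) + 2) * expectation (\<lambda>x. \<bar>real_of_int (Z i x)\<bar>)) \<le> L" .
  have Lpos: "0 < L" using \<open>0 < N\<close> A(1) by (simp add: L_def add_pos_nonneg)
  define C where "C = {z \<in> space (M \<Otimes>\<^sub>M M). \<forall>t\<in>F. \<bar>X t (fst z) - X t (snd z)\<bar> \<le> sqrt 2 * \<epsilon>}"
  have "C \<in> sets (M \<Otimes>\<^sub>M M)"
  proof -
    have [measurable]: "X t \<in> borel_measurable M" if "t \<in> F" for t using X F that by auto
    show ?thesis unfolding C_def using F(1) by measurable
  qed
  moreover have "(x, y) \<in> C" if xy: "x \<in> space M" "y \<in> space M" and eq: "\<And>i. i \<in> I \<Longrightarrow> Z i x = Z i y" for x y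
  proof -
    have "\<bar>X t x - X t y\<bar> \<le> sqrt 2 * \<epsilon>" if t: "t \<in> F" for t
    proof -
      obtain k where k: "k \<le> N * 2 ^ R" "t = real k * \<delta> / 2 ^ R" using t by (auto simp: F_def)
      have "\<bar>X t x - X t y\<bar> \<le> (\<Sum>j\<le>R. h j)"
        unfolding k(2)
        using same_quantization_dist[of h "\<lambda>t. X t x" "\<lambda>t. X t y" N R \<delta> R k] hpos X0 xy eq k(1)
        by (auto simp: I_def Z_def)
      also have "\<dots> \<le> 1 * \<epsilon>" using hsum by simp
      also have "\<dots> \<le> sqrt 2 * \<epsilon>" using \<open>0 < \<epsilon>\<close> by (intro mult_right_mono) auto
      finally show ?thesis .
    qed
    then show ?thesis using xy by (simp add: C_def space_pair_measure)
  qed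
  moreover have "Z i \<in> measurable M (count_space UNIV)" for i
    unfolding Z_def[abs_def] using X \<open>0 < \<delta>\<close> by (intro quantized_increment_measurable) auto
  ultimately have "exp (- 2 * L) / 4 \<le> measure (M \<Otimes>\<^sub>M M) C"
    by (intro coding_collision[OF I \<eta> _ Zint costL Lpos]) blast+
  also have "\<dots> = prob {\<omega> \<in> space M. \<forall>t\<in>F. \<bar>X t \<omega>\<bar> \<le> \<epsilon>}"
  proof -
    define u where "u = \<delta> / 2 ^ R"
    have F_eq: "F = (\<lambda>k. real k * u) ` {..N * 2 ^ R}" by (simp add: F_def u_def)
    have "0 < u" using \<open>0 < \<delta>\<close> by (simp add: u_def)
    then have "prob {\<omega> \<in> space M. \<forall>k\<in>{..N * 2 ^ R}. \<bar>X (real k * u) \<omega>\<bar> \<le> \<epsilon>} =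
      measure (M \<Otimes>\<^sub>M M) {z \<in> space (M \<Otimes>\<^sub>M M).
        \<forall>k\<in>{..N * 2 ^ R}. \<bar>X (real k * u) (fst z) - X (real k * u) (snd z)\<bar> \<le> sqrt 2 * \<epsilon>}"
      by (intro gaussian_symmetrization[where q = "q u (N * 2 ^ R)"] X char q) auto
    then show ?thesis unfolding C_def F_eq ball_simps by simp
  qed
  finally show ?thesis by (simp add: L_def F_def algebra_simps)
qed

text \<open>Continuity and density of the dyadic points. This replaces an uncountable supremum by
  countably many conditions, which makes the small ball event measurable.\<close>

lemma SUP_le_iff_dyadic:
  fixes f :: "real \<Rightarrow> real"
  assumes f: "continuous_on {0..T} f" and "0 < \<delta>" and T: "T = real N * \<delta>"
  shows "(SUP t\<in>{0..T}. \<bar>f t\<bar>) \<le> \<epsilon> \<longleftrightarrow> (\<forall>R. \<forall>t\<in>(\<lambda>k. real k * \<delta> / 2 ^ R) ` {..N * 2 ^ R}. \<bar>f t\<bar> \<le> \<epsilon>)"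
proof -
  define D where "D R = (\<lambda>k. real k * \<delta> / 2 ^ R) ` {..N * 2 ^ R}" for R
  have T0: "0 \<le> T" using \<open>0 < \<delta>\<close> by (simp add: T)
  have D: "D R \<subseteq> {0..T}" for R
  proof
    fix t assume "t \<in> D R"
    then obtain k where k: "k \<le> N * 2 ^ R" "t = real k * \<delta> / 2 ^ R" by (auto simp: D_def)
    have "real k \<le> real N * 2 ^ R" using k(1) by (metis of_nat_le_iff of_nat_mult of_nat_numeral of_nat_power)
    then have "real k * \<delta> \<le> (real N * 2 ^ R) * \<delta>" using \<open>0 < \<delta>\<close> by (intro mult_right_mono) auto
    then have "t \<le> T" by (simp add: T k(2) pos_divide_le_eq mult_ac)
    then show "t \<in> {0..T}" using \<open>0 < \<delta>\<close> by (simp add: k(2))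
  qed
  have cont: "continuous_on {0..T} (\<lambda>t. \<bar>f t\<bar>)" using f by (intro continuous_intros)
  then have bdd: "bdd_above ((\<lambda>t. \<bar>f t\<bar>) ` {0..T})"
    by (intro bounded_imp_bdd_above compact_imp_bounded compact_continuous_image) auto
  have "(SUP t\<in>{0..T}. \<bar>f t\<bar>) \<le> \<epsilon> \<longleftrightarrow> (\<forall>t\<in>{0..T}. \<bar>f t\<bar> \<le> \<epsilon>)"
    using T0 bdd by (intro cSUP_le_iff) auto
  also have "\<dots> \<longleftrightarrow> (\<forall>R. \<forall>t\<in>D R. \<bar>f t\<bar> \<le> \<epsilon>)"
  proof (intro iffI allI ballI)
    fix R t assume "\<forall>t\<in>{0..T}. \<bar>f t\<bar> \<le> \<epsilon>" "t \<in> D R"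
    then show "\<bar>f t\<bar> \<le> \<epsilon>" using D by blast
  next
    fix t assume *: "\<forall>R. \<forall>t\<in>D R. \<bar>f t\<bar> \<le> \<epsilon>" and t: "t \<in> {0..T}"
    \<comment> \<open>The last grid point of level \<open>R\<close> not beyond \<open>t\<close>; it
      is within \<open>\<delta> / 2 ^ R\<close> of \<open>t\<close>.\<close>
    define s where "s R = real (nat \<lfloor>t * 2 ^ R / \<delta>\<rfloor>) * \<delta> / 2 ^ R" for R
    have fl: "real (nat \<lfloor>t * 2 ^ R / \<delta>\<rfloor>) = of_int \<lfloor>t * 2 ^ R / \<delta>\<rfloor>" for R
      using t \<open>0 < \<delta>\<close> by simp
    have sD: "s R \<in> D R" for R
    proof -
      have "t * 2 ^ R / \<delta> \<le> real (N * 2 ^ R)"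
        using t \<open>0 < \<delta>\<close> by (simp add: T pos_divide_le_eq mult_ac)
      then have "nat \<lfloor>t * 2 ^ R / \<delta>\<rfloor> \<le> N * 2 ^ R" by (simp add: nat_le_iff floor_le_iff)
      then show ?thesis by (auto simp: s_def D_def)
    qed
    have st: "\<bar>s R - t\<bar> \<le> \<delta> * (1 / 2) ^ R" for R
    proof -
      have "s R - t = (of_int \<lfloor>t * 2 ^ R / \<delta>\<rfloor> - t * 2 ^ R / \<delta>) * \<delta> / 2 ^ R"
        unfolding s_def fl using \<open>0 < \<delta>\<close> by (simp add: left_diff_distrib diff_divide_distrib)
      then have "\<bar>s R - t\<bar> = \<bar>of_int \<lfloor>t * 2 ^ R / \<delta>\<rfloor> - t * 2 ^ R / \<delta>\<bar> * \<delta> / 2 ^ R"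
        using \<open>0 < \<delta>\<close> by (simp add: abs_mult)
      also have "\<dots> \<le> 1 * \<delta> / 2 ^ R"
        using \<open>0 < \<delta>\<close> by (intro divide_right_mono mult_right_mono) (auto, linarith)
      finally show ?thesis by (simp add: power_divide)
    qed
    have "(\<lambda>R. \<delta> * (1 / 2) ^ R) \<longlonglongrightarrow> \<delta> * 0"
      by (intro tendsto_mult tendsto_const LIMSEQ_power_zero) auto
    then have null: "(\<lambda>R. \<delta> * (1 / 2) ^ R) \<longlonglongrightarrow> 0" by simp
    have "(\<lambda>R. s R - t) \<longlonglongrightarrow> 0"
      by (rule Lim_null_comparison[OF always_eventually null]) (use st in simp)
    then have "s \<longlonglongrightarrow> t" by (simp add: LIM_zero_iff)
    then have "(\<lambda>R. \<bar>f (s R)\<bar>) \<longlonglongrightarrow> \<bar>f t\<bar>"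
      by (rule continuous_on_tendsto_compose[OF cont _ t always_eventually]) (use sD D in blast)
    then show "\<bar>f t\<bar> \<le> \<epsilon>"
      by (rule LIMSEQ_le_const2) (use * sD in blast)
  qed
  finally show ?thesis unfolding D_def .
qed

lemma small_ball_event:
  fixes X :: "real \<Rightarrow> 'a \<Rightarrow> real"
  assumes X: "\<And>t. 0 \<le> t \<Longrightarrow> random_variable borel (X t)" and cont: "continuous_paths M X"
    and "0 < \<delta>" and T: "T = real N * \<delta>"
  shows "{\<omega> \<in> space M. (SUP t\<in>{0..T}. \<bar>X t \<omega>\<bar>) \<le> \<epsilon>} =
      (\<Inter>R. {\<omega> \<in> space M. \<forall>t\<in>(\<lambda>k. real k * \<delta> / 2 ^ R) ` {..N * 2 ^ R}. \<bar>X t \<omega>\<bar> \<le> \<epsilon>})" (is "?S = (\<Inter>R. ?E R)")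
    and "{\<omega> \<in> space M. \<forall>t\<in>(\<lambda>k. real k * \<delta> / 2 ^ R) ` {..N * 2 ^ R}. \<bar>X t \<omega>\<bar> \<le> \<epsilon>} \<in> events"
    and "{\<omega> \<in> space M. (SUP t\<in>{0..T}. \<bar>X t \<omega>\<bar>) \<le> \<epsilon>} \<in> events"
proof -
  have "continuous_on {0..T} (\<lambda>t. X t \<omega>)" if "\<omega> \<in> space M" for \<omega>
    using cont that unfolding continuous_paths_def by (auto intro: continuous_on_subset)
  note iff = SUP_le_iff_dyadic[OF this \<open>0 < \<delta>\<close> T]
  show eq: "?S = (\<Inter>R. ?E R)" using iff by auto
  show E: "?E R \<in> events" for R
  proof -
    have [measurable]: "X t \<in> borel_measurable M" if "t \<in> (\<lambda>k. real k * \<delta> / 2 ^ R) ` {..N * 2 ^ R}" for t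
      using X that \<open>0 < \<delta>\<close> by auto
    show ?thesis by measurable
  qed
  show "?S \<in> events" unfolding eq using E by blast
qed

text \<open>The grids are nested, so the grid events decrease to the small ball event, and a bound
  uniform in \<open>R\<close> survives by continuity from above.\<close>

lemma small_ball_ge_of_grid:
  fixes X :: "real \<Rightarrow> 'a \<Rightarrow> real"
  assumes X: "\<And>t. 0 \<le> t \<Longrightarrow> random_variable borel (X t)" and cont: "continuous_paths M X"
    and "0 < \<delta>" and T: "T = real N * \<delta>"
    and p: "\<And>R. p \<le> prob {\<omega> \<in> space M. \<forall>t\<in>(\<lambda>k. real k * \<delta> / 2 ^ R) ` {..N * 2 ^ R}. \<bar>X t \<omega>\<bar> \<le> \<epsilon>}"
  shows "p \<le> small_ball_prob T X \<epsilon>"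
proof -
  define E where "E R = {\<omega> \<in> space M. \<forall>t\<in>(\<lambda>k. real k * \<delta> / 2 ^ R) ` {..N * 2 ^ R}. \<bar>X t \<omega>\<bar> \<le> \<epsilon>}" for R
  note ev = small_ball_event[OF X cont \<open>0 < \<delta>\<close> T, where \<epsilon> = \<epsilon>]
  have "decseq E"
  proof (rule decseq_SucI)
    fix R
    have "(\<lambda>k. real k * \<delta> / 2 ^ R) ` {..N * 2 ^ R} \<subseteq> (\<lambda>k. real k * \<delta> / 2 ^ Suc R) ` {..N * 2 ^ Suc R}"
    proof (rule image_subsetI)
      fix k assume "k \<in> {..N * 2 ^ R}"
      then show "real k * \<delta> / 2 ^ R \<in> (\<lambda>k. real k * \<delta> / 2 ^ Suc R) ` {..N * 2 ^ Suc R}"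
        by (intro image_eqI[of _ _ "2 * k"]) auto
    qed
    then show "E (Suc R) \<subseteq> E R" unfolding E_def by blast
  qed
  then have "(\<lambda>R. prob (E R)) \<longlonglongrightarrow> prob (\<Inter>R. E R)"
    using ev(2) by (intro finite_Lim_measure_decseq) (auto simp only: E_def[abs_def])
  then have "p \<le> prob (\<Inter>R. E R)"
    using p by (intro LIMSEQ_le_const) (auto simp only: E_def)
  then show ?thesis unfolding small_ball_prob_def E_def by (subst ev(1))
qed

end

section \<open>Gaussian, fractional Brownian and Wiener increments\<close>

context prob_space
begin

section \<open>Moments and characteristic functions of one-dimensional normal laws\<close>

lemma normal_iexp:
  fixes X :: "'a \<Rightarrow> real"
  assumes "0 < \<sigma>" and X: "distributed M lborel X (normal_density 0 \<sigma>)"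
  shows "expectation (\<lambda>\<omega>. iexp (t * X \<omega>)) = of_real (exp (- (t\<^sup>2 * \<sigma>\<^sup>2) / 2))"
proof -
  define Z where "Z \<omega> = X \<omega> / \<sigma>" for \<omega>
  have Z: "distributed M lborel Z std_normal_density"
    using normal_standard_normal_convert[OF \<open>0 < \<sigma>\<close>, of X 0] X by (simp add: Z_def[abs_def])
  have [measurable]: "Z \<in> borel_measurable M" using distributed_measurable[OF Z] by simp
  have "expectation (\<lambda>\<omega>. iexp (t * X \<omega>)) = expectation (\<lambda>\<omega>. iexp (t * \<sigma> * Z \<omega>))"
    using \<open>0 < \<sigma>\<close> by (simp add: Z_def)
  also have "\<dots> = (CLINT z|distr M lborel Z. iexp (t * \<sigma> * z))"
    by (subst integral_distr) simp_all
  also have "\<dots> = char std_normal_distribution (t * \<sigma>)"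
    unfolding char_def distributed_distr_eq_density[OF Z] by simp
  finally show ?thesis by (simp add: char_std_normal_distribution power_mult_distrib)
qed

lemma normal_even_moment:
  fixes X :: "'a \<Rightarrow> real"
  assumes "0 < \<sigma>" and X: "distributed M lborel X (normal_density 0 \<sigma>)"
  shows "integrable M (\<lambda>\<omega>. X \<omega> ^ (2 * k))"
    and "expectation (\<lambda>\<omega>. X \<omega> ^ (2 * k)) = (\<sigma>\<^sup>2) ^ k * (fact (2 * k) / (2 ^ k * fact k))"
proof -
  show "integrable M (\<lambda>\<omega>. X \<omega> ^ (2 * k))"
    using integrable_normal_moment[OF \<open>0 < \<sigma>\<close>, of 0 "2 * k"]
    by (subst distributed_integrable[OF X, symmetric]) auto
  have "expectation (\<lambda>\<omega>. X \<omega> ^ (2 * k)) = fact (2 * k) / ((2 / \<sigma>\<^sup>2)^k * fact k)"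
    using integral_normal_moment_even[OF \<open>0 < \<sigma>\<close>, of 0 k]
    by (subst distributed_integral[OF X, symmetric]) auto
  then show "expectation (\<lambda>\<omega>. X \<omega> ^ (2 * k)) = (\<sigma>\<^sup>2) ^ k * (fact (2 * k) / (2 ^ k * fact k))"
    using \<open>0 < \<sigma>\<close> by (simp add: power_divide)
qed

lemma centered_gaussian_cases:
  assumes "gaussian_variable X" "expectation X = 0"
  obtains \<sigma> where "0 < \<sigma>" "distributed M lborel X (normal_density 0 \<sigma>)" | "AE \<omega> in M. X \<omega> = 0"
proof -
  have rv: "random_variable borel X" using assms by (simp add: gaussian_variable_def)
  from assms(1) consider \<mu> \<sigma> where "0 < \<sigma>" "distributed M lborel X (normal_density \<mu> \<sigma>)"
    | \<mu> where "AE \<omega> in M. X \<omega> = \<mu>"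
    unfolding gaussian_variable_def by blast
  then show thesis
  proof cases
    case 1
    then show thesis using that(1) normal_distributed_expectation[OF 1] assms(2) by auto
  next
    case (2 \<mu>)
    have "expectation X = expectation (\<lambda>_. \<mu>)" using 2 rv by (intro integral_cong_AE) auto
    then show thesis using 2 assms(2) that(2) by (simp add: prob_space)
  qed
qed

text \<open>Expressing the moment through the variance lets one formula cover the nondegenerate and
  the degenerate law.\<close>

lemma gaussian_variable_even_moment:
  assumes X: "gaussian_variable X" "expectation X = 0" and "1 \<le> k"
  shows "integrable M (\<lambda>\<omega>. X \<omega> ^ (2 * k))"
    and "expectation (\<lambda>\<omega>. X \<omega> ^ (2 * k)) = (expectation (\<lambda>\<omega>. (X \<omega>)\<^sup>2)) ^ k * (fact (2 * k) / (2 ^ k * fact k))"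
proof -
  have [measurable]: "random_variable borel X" using assms by (simp add: gaussian_variable_def)
  have "integrable M (\<lambda>\<omega>. X \<omega> ^ (2 * k)) \<and>
    expectation (\<lambda>\<omega>. X \<omega> ^ (2 * k)) = (expectation (\<lambda>\<omega>. (X \<omega>)\<^sup>2)) ^ k * (fact (2 * k) / (2 ^ k * fact k))"
  proof (cases rule: centered_gaussian_cases[OF X])
    case (1 \<sigma>)
    then show ?thesis
      using normal_even_moment[OF 1, of k] normal_even_moment(2)[OF 1, of 1] by (simp add: fact_numeral)
  next
    case 2
    have z: "expectation (\<lambda>\<omega>. X \<omega> ^ (2 * j)) = 0" "integrable M (\<lambda>\<omega>. X \<omega> ^ (2 * j))" if "1 \<le> j" for j
    proof -
      have ae: "AE \<omega> in M. X \<omega> ^ (2 * j) = 0" using 2 by eventually_elim (use that in auto)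
      then have "expectation (\<lambda>\<omega>. X \<omega> ^ (2 * j)) = expectation (\<lambda>_. 0)" by (intro integral_cong_AE) auto
      then show "expectation (\<lambda>\<omega>. X \<omega> ^ (2 * j)) = 0" by simp
      have "integrable M (\<lambda>\<omega>. X \<omega> ^ (2 * j)) \<longleftrightarrow> integrable M (\<lambda>_. 0 :: real)"
        using ae by (intro integrable_cong_AE) auto
      then show "integrable M (\<lambda>\<omega>. X \<omega> ^ (2 * j))" by simp
    qed
    show ?thesis using z[OF \<open>1 \<le> k\<close>] z(1)[of 1] \<open>1 \<le> k\<close> by simp
  qed
  then show "integrable M (\<lambda>\<omega>. X \<omega> ^ (2 * k))"
    and "expectation (\<lambda>\<omega>. X \<omega> ^ (2 * k)) = (expectation (\<lambda>\<omega>. (X \<omega>)\<^sup>2)) ^ k * (fact (2 * k) / (2 ^ k * fact k))"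
    by auto
qed

lemma gaussian_variable_iexp:
  assumes X: "gaussian_variable X" "expectation X = 0"
  shows "expectation (\<lambda>\<omega>. iexp (X \<omega>)) = of_real (exp (- expectation (\<lambda>\<omega>. (X \<omega>)\<^sup>2) / 2))"
proof -
  have [measurable]: "random_variable borel X" using assms by (simp add: gaussian_variable_def)
  show ?thesis
  proof (cases rule: centered_gaussian_cases[OF X])
    case (1 \<sigma>)
    then show ?thesis
      using normal_iexp[OF 1, of 1] normal_even_moment(2)[OF 1, of 1] by (simp add: fact_numeral)
  next
    case 2
    have "expectation (\<lambda>\<omega>. iexp (X \<omega>)) = expectation (\<lambda>_. 1)"
      using 2 by (intro integral_cong_AE) auto
    moreover have "expectation (\<lambda>\<omega>. (X \<omega>)\<^sup>2) = expectation (\<lambda>_. 0)"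
      using 2 by (intro integral_cong_AE) auto
    ultimately show ?thesis by (simp add: prob_space)
  qed
qed

text \<open>The Bochner integral of a non-integrable function is 0 by convention, so an expectation
  equal to 0 does not by itself permit linearity; this supplies the integrability.\<close>

lemma gaussian_variable_integrable:
  assumes "gaussian_variable X"
  shows "integrable M X"
proof -
  have [measurable]: "random_variable borel X" using assms by (simp add: gaussian_variable_def)
  from assms consider \<mu> \<sigma> where "0 < \<sigma>" "distributed M lborel X (normal_density \<mu> \<sigma>)"
    | \<mu> where "AE \<omega> in M. X \<omega> = \<mu>"
    unfolding gaussian_variable_def by blast
  then show ?thesis
  proof cases
    case (1 \<mu> \<sigma>)
    show ?thesis
      by (rule distributed_integrable_var[OF 1(2)]) (auto intro: integrable_normal_moment_nz_1[OF 1(1)])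
  next
    case (2 \<mu>)
    then have "integrable M X \<longleftrightarrow> integrable M (\<lambda>_. \<mu>)" by (intro integrable_cong_AE) auto
    then show ?thesis by simp
  qed
qed

text \<open>\<open>gaussian_process\<close> speaks of sets of times, whereas increments lead to
  families in which a time may recur; coefficients at equal times are merged.\<close>

lemma gaussian_process_sum:
  assumes "gaussian_process B" "finite A" "\<And>i. i \<in> A \<Longrightarrow> 0 \<le> f i"
  shows "gaussian_variable (\<lambda>\<omega>. \<Sum>i\<in>A. c i * B (f i) \<omega>)"
proof -
  have "(\<Sum>i\<in>A. c i * B (f i) \<omega>) = (\<Sum>t\<in>f ` A. (\<Sum>i\<in>{i\<in>A. f i = t}. c i) * B t \<omega>)" for \<omega>
  proof -
    have "(\<Sum>i\<in>A. c i * B (f i) \<omega>) = (\<Sum>t\<in>f ` A. \<Sum>i\<in>{i\<in>A. f i = t}. c i * B (f i) \<omega>)"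
      by (rule sum.image_gen[OF \<open>finite A\<close>])
    also have "\<dots> = (\<Sum>t\<in>f ` A. (\<Sum>i\<in>{i\<in>A. f i = t}. c i) * B t \<omega>)"
      by (intro sum.cong refl) (auto simp: sum_distrib_right intro!: sum.cong)
    finally show ?thesis .
  qed
  moreover have "gaussian_variable (\<lambda>\<omega>. \<Sum>t\<in>f ` A. (\<Sum>i\<in>{i\<in>A. f i = t}. c i) * B t \<omega>)"
  proof -
    have "finite (f ` A) \<and> f ` A \<subseteq> {0..}" using assms(2,3) by auto
    with assms(1) show ?thesis
      unfolding gaussian_process_def by (elim allE[of _ "f ` A"] allE[of _ "\<lambda>t. \<Sum>i\<in>{i\<in>A. f i = t}. c i"]) simp
  qed
  ultimately show ?thesis by simp
qed

lemma gaussian_process_at: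
  assumes "gaussian_process B" "0 \<le> t"
  shows "gaussian_variable (B t)"
proof -
  have "gaussian_variable (\<lambda>\<omega>. \<Sum>s\<in>{t}. 1 * B s \<omega>)"
    by (rule gaussian_process_sum[OF assms(1)]) (use assms(2) in auto)
  then show ?thesis by simp
qed

section \<open>Second-order structure and characteristic functions of the two processes\<close>

lemma fbm_facts:
  assumes B: "fractional_brownian_motion H B"
  shows "gaussian_process B"
    and "\<And>t. 0 \<le> t \<Longrightarrow> random_variable borel (B t)"
    and "\<And>t. 0 \<le> t \<Longrightarrow> integrable M (B t)"
    and "\<And>t. 0 \<le> t \<Longrightarrow> expectation (B t) = 0"
    and "\<And>s t. 0 \<le> s \<Longrightarrow> 0 \<le> t \<Longrightarrow> integrable M (\<lambda>\<omega>. B s \<omega> * B t \<omega>)"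
    and "\<And>s t. 0 \<le> s \<Longrightarrow> 0 \<le> t \<Longrightarrow> expectation (\<lambda>\<omega>. B s \<omega> * B t \<omega>) =
        1 / 2 * (s powr (2 * H) + t powr (2 * H) - \<bar>s - t\<bar> powr (2 * H))"
    and "continuous_paths M B"
proof -
  show gp: "gaussian_process B" and "continuous_paths M B"
    using B by (auto simp: fractional_brownian_motion_def)
  show rv: "random_variable borel (B t)" and "integrable M (B t)" if "0 \<le> t" for t
    using gaussian_process_at[OF gp that] gaussian_variable_integrable[OF gaussian_process_at[OF gp that]]
    by (simp_all only: gaussian_variable_def)
  show E: "expectation (B t) = 0" if "0 \<le> t" for t
    using B that by (auto simp: fractional_brownian_motion_def)
  show "integrable M (\<lambda>\<omega>. B s \<omega> * B t \<omega>)" if "0 \<le> s" "0 \<le> t" for s t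
  proof (rule Bochner_Integration.integrable_bound)
    have "integrable M (\<lambda>\<omega>. (B u \<omega>)\<^sup>2)" if "0 \<le> u" for u
      using gaussian_variable_even_moment(1)[OF gaussian_process_at[OF gp that] E[OF that], of 1] by simp
    then show "integrable M (\<lambda>\<omega>. (B s \<omega>)\<^sup>2 + (B t \<omega>)\<^sup>2)" using that by auto
    show "(\<lambda>\<omega>. B s \<omega> * B t \<omega>) \<in> borel_measurable M" using rv that by (intro borel_measurable_times) auto
    have "\<bar>a * b\<bar> \<le> a\<^sup>2 + b\<^sup>2" for a b :: real
    proof -
      have "2 * \<bar>a\<bar> * \<bar>b\<bar> \<le> \<bar>a\<bar>\<^sup>2 + \<bar>b\<bar>\<^sup>2" by (rule sum_squares_bound)
      moreover have "0 \<le> \<bar>a\<bar> * \<bar>b\<bar>" by simp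
      ultimately have "\<bar>a\<bar> * \<bar>b\<bar> \<le> \<bar>a\<bar>\<^sup>2 + \<bar>b\<bar>\<^sup>2" by linarith
      then show ?thesis by (simp add: abs_mult)
    qed
    then show "AE \<omega> in M. norm (B s \<omega> * B t \<omega>) \<le> norm ((B s \<omega>)\<^sup>2 + (B t \<omega>)\<^sup>2)" by simp
  qed
  show "expectation (\<lambda>\<omega>. B s \<omega> * B t \<omega>) = 1 / 2 * (s powr (2 * H) + t powr (2 * H) - \<bar>s - t\<bar> powr (2 * H))"
    if "0 \<le> s" "0 \<le> t" for s t
  proof -
    have "covariance (B s) (B t) = expectation (\<lambda>\<omega>. B s \<omega> * B t \<omega>)"
      using E that by (simp add: covariance_def)
    moreover have "\<forall>s\<ge>0. \<forall>t\<ge>0. covariance (B t) (B s) =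
        1 / 2 * (t powr (2 * H) + s powr (2 * H) - \<bar>t - s\<bar> powr (2 * H))"
      using B unfolding fractional_brownian_motion_def by blast
    ultimately show ?thesis using that by metis
  qed
qed

text \<open>Bilinearity cancels the terms of the covariance that belong to single times; what
  remains depends only on differences of times.\<close>

lemma fbm_increment_product:
  assumes B: "fractional_brownian_motion H B" and t: "0 \<le> a" "0 \<le> b" "0 \<le> c" "0 \<le> d"
  shows "integrable M (\<lambda>\<omega>. (B a \<omega> - B b \<omega>) * (B c \<omega> - B d \<omega>))"
    and "expectation (\<lambda>\<omega>. (B a \<omega> - B b \<omega>) * (B c \<omega> - B d \<omega>)) =
      1 / 2 * (\<bar>a - d\<bar> powr (2 * H) + \<bar>b - c\<bar> powr (2 * H) - \<bar>a - c\<bar> powr (2 * H) - \<bar>b - d\<bar> powr (2 * H))"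
proof -
  note i = fbm_facts(5)[OF B] and e = fbm_facts(6)[OF B]
  have eq: "(B a \<omega> - B b \<omega>) * (B c \<omega> - B d \<omega>) =
      B a \<omega> * B c \<omega> - B a \<omega> * B d \<omega> - B b \<omega> * B c \<omega> + B b \<omega> * B d \<omega>" for \<omega>
    by (simp add: algebra_simps)
  show "integrable M (\<lambda>\<omega>. (B a \<omega> - B b \<omega>) * (B c \<omega> - B d \<omega>))"
    unfolding eq using i t by auto
  have "expectation (\<lambda>\<omega>. (B a \<omega> - B b \<omega>) * (B c \<omega> - B d \<omega>)) =
      expectation (\<lambda>\<omega>. B a \<omega> * B c \<omega>) - expectation (\<lambda>\<omega>. B a \<omega> * B d \<omega>)
      - expectation (\<lambda>\<omega>. B b \<omega> * B c \<omega>) + expectation (\<lambda>\<omega>. B b \<omega> * B d \<omega>)"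
    unfolding eq using i t by simp
  then show "expectation (\<lambda>\<omega>. (B a \<omega> - B b \<omega>) * (B c \<omega> - B d \<omega>)) =
      1 / 2 * (\<bar>a - d\<bar> powr (2 * H) + \<bar>b - c\<bar> powr (2 * H) - \<bar>a - c\<bar> powr (2 * H) - \<bar>b - d\<bar> powr (2 * H))"
    using e t by (simp add: algebra_simps)
qed

lemma fbm_zero:
  assumes B: "fractional_brownian_motion H B"
  shows "AE \<omega> in M. B 0 \<omega> = 0"
proof -
  have "expectation (\<lambda>\<omega>. B 0 \<omega> * B 0 \<omega>) = 0" "integrable M (\<lambda>\<omega>. B 0 \<omega> * B 0 \<omega>)"
    using fbm_facts(5,6)[OF B, of 0 0] by simp_all
  then have "AE \<omega> in M. B 0 \<omega> * B 0 \<omega> = 0"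
    by (subst integral_nonneg_eq_0_iff_AE[symmetric]) auto
  then show ?thesis by eventually_elim simp
qed

lemma fbm_sum_iexp:
  assumes B: "fractional_brownian_motion H B" and A: "finite A" "\<And>i. i \<in> A \<Longrightarrow> 0 \<le> f i"
  shows "expectation (\<lambda>\<omega>. iexp (\<Sum>i\<in>A. c i * B (f i) \<omega>)) =
    of_real (exp (- expectation (\<lambda>\<omega>. (\<Sum>i\<in>A. c i * B (f i) \<omega>)\<^sup>2) / 2))"
proof (rule gaussian_variable_iexp)
  show "gaussian_variable (\<lambda>\<omega>. \<Sum>i\<in>A. c i * B (f i) \<omega>)"
    using fbm_facts(1)[OF B] A by (rule gaussian_process_sum)
  show "expectation (\<lambda>\<omega>. \<Sum>i\<in>A. c i * B (f i) \<omega>) = 0"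
    using fbm_facts(3,4)[OF B] A by (subst Bochner_Integration.integral_sum) auto
qed

text \<open>Summation by parts writes the linear form through the independent increments
  \<open>D j\<close> over the grid cells; cell \<open>j\<close> contributes the variance
  \<open>u * (a j)\<^sup>2\<close>.\<close>

lemma wiener_sum_iexp:
  assumes W: "wiener_process W" and u: "0 < u"
  shows "expectation (\<lambda>\<omega>. iexp (\<Sum>k\<le>n. \<theta> k * (W (real k * u) \<omega> - W 0 \<omega>))) =
    of_real (exp (- (u * (\<Sum>j<n. (\<Sum>k=Suc j..n. \<theta> k)\<^sup>2) / 2)))"
proof -
  define D where "D j \<omega> = W (real (Suc j) * u) \<omega> - W (real j * u) \<omega>" for j \<omega>
  define a where "a j = (\<Sum>k=Suc j..n. \<theta> k)" for j
  have rv[measurable]: "random_variable borel (D j)" for j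
  proof -
    have "random_variable borel (W t)" if "0 \<le> t" for t
      using W that by (simp add: wiener_process_def)
    then show ?thesis using u unfolding D_def[abs_def] by (intro borel_measurable_diff) simp_all
  qed
  have sum: "(\<Sum>k\<le>n. \<theta> k * (W (real k * u) \<omega> - W 0 \<omega>)) = (\<Sum>j<n. a j * D j \<omega>)" for \<omega>
  proof -
    have "W (real k * u) \<omega> - W 0 \<omega> = (\<Sum>j<k. D j \<omega>)" for k
      unfolding D_def by (subst sum_lessThan_telescope) simp
    then have "(\<Sum>k\<le>n. \<theta> k * (W (real k * u) \<omega> - W 0 \<omega>)) = (\<Sum>k\<le>n. \<Sum>j<k. \<theta> k * D j \<omega>)"
      by (simp add: sum_distrib_left)
    also have "\<dots> = (\<Sum>j<n. \<Sum>k=Suc j..n. \<theta> k * D j \<omega>)" by (rule sum.nested_swap')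
    finally show ?thesis by (simp add: a_def sum_distrib_right)
  qed
  have norm: "distributed M lborel (D j) (normal_density 0 (sqrt u))" for j
  proof -
    have "real (Suc j) * u - real j * u = u" by (simp add: algebra_simps)
    moreover have "0 \<le> real j * u \<and> real j * u < real (Suc j) * u" using u by simp
    moreover have "0 \<le> s \<Longrightarrow> s < t \<Longrightarrow>
        distributed M lborel (\<lambda>\<omega>. W t \<omega> - W s \<omega>) (normal_density 0 (sqrt (t - s)))" for s t
      using W by (simp add: wiener_process_def)
    ultimately show ?thesis unfolding D_def[abs_def] by metis
  qed
  have "indep_vars (\<lambda>_. borel) (\<lambda>j \<omega>. W (real (Suc j) * u) \<omega> - W (real j * u) \<omega>) {..<n}"
  proof -
    have "mono (\<lambda>j. real j * u)" using u by (intro monoI mult_right_mono) auto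
    have iv: "0 \<le> \<tau> 0 \<Longrightarrow> mono \<tau> \<Longrightarrow>
        indep_vars (\<lambda>_. borel) (\<lambda>i \<omega>. W (\<tau> (Suc i)) \<omega> - W (\<tau> i) \<omega>) {..<n}" for \<tau>
      using W by (simp add: wiener_process_def)
    show ?thesis
      by (rule iv[of "\<lambda>j. real j * u"]) (use \<open>mono (\<lambda>j. real j * u)\<close> in simp_all)
  qed
  then have "indep_vars (\<lambda>_. borel) (\<lambda>j \<omega>. a j * D j \<omega>) {..<n}"
    unfolding D_def by (rule indep_vars_compose2[where Y = "\<lambda>j x. a j * x"]) auto
  from char_distr_sum[OF this, of 1]
  have "expectation (\<lambda>\<omega>. iexp (\<Sum>j<n. a j * D j \<omega>)) = (\<Prod>j<n. expectation (\<lambda>\<omega>. iexp (a j * D j \<omega>)))"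
    by (simp add: char_def integral_distr)
  also have "\<dots> = (\<Prod>j<n. of_real (exp (- ((a j)\<^sup>2 * u) / 2)))"
    using normal_iexp[OF _ norm] u by (intro prod.cong refl) simp
  also have "\<dots> = of_real (exp (\<Sum>j<n. - ((a j)\<^sup>2 * u) / 2))"
    by (simp add: exp_sum)
  also have "(\<Sum>j<n. - ((a j)\<^sup>2 * u) / 2) = - (u * (\<Sum>j<n. (a j)\<^sup>2) / 2)"
    by (simp add: sum_negf sum_distrib_left sum_divide_distrib mult.commute)
  finally show ?thesis unfolding sum a_def .
qed

text \<open>Linear forms in finitely many coordinates are measurable on the product space, so
  independence of the whole paths passes to them, and the characteristic function of their sum
  factorises.\<close>

lemma independent_sum_iexp:
  assumes ind: "independent_processes X Y" and A: "finite A" "\<And>i. i \<in> A \<Longrightarrow> 0 \<le> f i"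
    and C: "finite C" "\<And>i. i \<in> C \<Longrightarrow> 0 \<le> g i"
  shows "expectation (\<lambda>\<omega>. iexp ((\<Sum>i\<in>A. c i * X (f i) \<omega>) + (\<Sum>i\<in>C. d i * Y (g i) \<omega>))) =
    expectation (\<lambda>\<omega>. iexp (\<Sum>i\<in>A. c i * X (f i) \<omega>)) * expectation (\<lambda>\<omega>. iexp (\<Sum>i\<in>C. d i * Y (g i) \<omega>))"
proof -
  have [measurable]: "(\<lambda>x. x (f i)) \<in> borel_measurable (\<Pi>\<^sub>M t\<in>{0..}. borel)" if "i \<in> A" for i
    using A(2)[OF that] by (intro measurable_component_singleton) auto
  have [measurable]: "(\<lambda>x. x (g i)) \<in> borel_measurable (\<Pi>\<^sub>M t\<in>{0..}. borel)" if "i \<in> C" for i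
    using C(2)[OF that] by (intro measurable_component_singleton) auto
  have "indep_var borel ((\<lambda>x. \<Sum>i\<in>A. c i * x (f i)) \<circ> (\<lambda>\<omega>. \<lambda>t\<in>{0..}. X t \<omega>))
      borel ((\<lambda>x. \<Sum>i\<in>C. d i * x (g i)) \<circ> (\<lambda>\<omega>. \<lambda>t\<in>{0..}. Y t \<omega>))"
    using ind unfolding independent_processes_def by (rule indep_var_compose) measurable
  also have "(\<lambda>x. \<Sum>i\<in>A. c i * x (f i)) \<circ> (\<lambda>\<omega>. \<lambda>t\<in>{0..}. X t \<omega>) = (\<lambda>\<omega>. \<Sum>i\<in>A. c i * X (f i) \<omega>)"
    using A(2) by (auto simp: fun_eq_iff intro!: sum.cong)
  also have "(\<lambda>x. \<Sum>i\<in>C. d i * x (g i)) \<circ> (\<lambda>\<omega>. \<lambda>t\<in>{0..}. Y t \<omega>) = (\<lambda>\<omega>. \<Sum>i\<in>C. d i * Y (g i) \<omega>)"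
    using C(2) by (auto simp: fun_eq_iff intro!: sum.cong)
  finally have iv: "indep_var borel (\<lambda>\<omega>. \<Sum>i\<in>A. c i * X (f i) \<omega>) borel (\<lambda>\<omega>. \<Sum>i\<in>C. d i * Y (g i) \<omega>)" .
  have [measurable]: "random_variable borel (\<lambda>\<omega>. \<Sum>i\<in>A. c i * X (f i) \<omega>)"
    "random_variable borel (\<lambda>\<omega>. \<Sum>i\<in>C. d i * Y (g i) \<omega>)"
    using indep_var_rv1[OF iv] indep_var_rv2[OF iv] by auto
  show ?thesis using char_distr_add[OF iv, of 1] by (simp add: char_def integral_distr)
qed

end

section \<open>Negatively correlated increments\<close>

text \<open>Concavity of the power, taken from its tangent at 1:
  \<open>y powr a \<le> 1 + a * (y - 1)\<close> at \<open>y = (x + 1) / x\<close> and at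
  \<open>y = (x - 1) / x\<close>, where the linear terms cancel.\<close>

lemma powr_second_difference_nonpos:
  fixes a x :: real
  assumes "0 < a" "a < 1" "1 < x"
  shows "(x + 1) powr a + (x - 1) powr a \<le> 2 * x powr a"
proof -
  have bern: "y powr a \<le> 1 + a * (y - 1)" if "0 < y" for y
    using Youngs_inequality_0[of a "1 - a" y 1] assms that by (simp add: algebra_simps)
  have "((x + 1) / x) powr a + ((x - 1) / x) powr a \<le> (1 + a * ((x + 1) / x - 1)) + (1 + a * ((x - 1) / x - 1))"
    using assms by (intro add_mono bern) auto
  also have "\<dots> = 2" using assms by (simp add: field_simps)
  finally have "((x + 1) powr a + (x - 1) powr a) / x powr a \<le> 2"
    using assms by (subst add_divide_distrib) (simp only: powr_divide)
  then show ?thesis using assms by (simp add: pos_divide_le_eq)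
qed

text \<open>Off the diagonal, \<open>2 * \<bar>\<xi> k * \<xi> l\<bar>\<close> is at most the sum of
  the two squares. By symmetry of \<open>g\<close> both squares lead to the same absolute row sums,
  which the diagonal outweighs by \<open>c\<close>.\<close>

lemma diagonally_dominant_quadratic_form:
  fixes g :: "'i \<Rightarrow> 'i \<Rightarrow> real" and \<xi> :: "'i \<Rightarrow> real"
  assumes "finite A" and sym: "\<And>k l. k \<in> A \<Longrightarrow> l \<in> A \<Longrightarrow> g k l = g l k"
    and dom: "\<And>k. k \<in> A \<Longrightarrow> (\<Sum>l\<in>A - {k}. \<bar>g k l\<bar>) \<le> g k k - c"
  shows "c * (\<Sum>k\<in>A. (\<xi> k)\<^sup>2) \<le> (\<Sum>k\<in>A. \<Sum>l\<in>A. \<xi> k * \<xi> l * g k l)"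
proof -
  define h where "h k l = (if k = l then 0 else \<bar>g k l\<bar>)" for k l
  have hsum: "(\<Sum>l\<in>A. h k l) \<le> g k k - c" if "k \<in> A" for k
  proof -
    have "(\<Sum>l\<in>A. h k l) = h k k + (\<Sum>l\<in>A - {k}. h k l)" using assms(1) that by (rule sum.remove)
    also have "(\<Sum>l\<in>A - {k}. h k l) = (\<Sum>l\<in>A - {k}. \<bar>g k l\<bar>)" by (intro sum.cong) (auto simp: h_def)
    finally show ?thesis using dom[OF that] by (simp add: h_def)
  qed
  have term_le: "(if k = l then g k k * (\<xi> k)\<^sup>2 else 0) - h k l * ((\<xi> k)\<^sup>2 + (\<xi> l)\<^sup>2) / 2 \<le> \<xi> k * \<xi> l * g k l" for k l
  proof (cases "k = l")
    case False
    have "\<bar>\<xi> k * \<xi> l * g k l\<bar> = \<bar>g k l\<bar> * (\<bar>\<xi> k\<bar> * \<bar>\<xi> l\<bar>)" by (simp add: abs_mult)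
    also have "\<dots> \<le> \<bar>g k l\<bar> * (((\<xi> k)\<^sup>2 + (\<xi> l)\<^sup>2) / 2)"
      using sum_squares_bound[of "\<bar>\<xi> k\<bar>" "\<bar>\<xi> l\<bar>"] by (intro mult_left_mono) auto
    finally show ?thesis using False by (simp add: h_def)
  qed (simp add: h_def power2_eq_square)
  have "(\<Sum>k\<in>A. \<Sum>l\<in>A. (if k = l then g k k * (\<xi> k)\<^sup>2 else 0) - h k l * ((\<xi> k)\<^sup>2 + (\<xi> l)\<^sup>2) / 2)
      \<le> (\<Sum>k\<in>A. \<Sum>l\<in>A. \<xi> k * \<xi> l * g k l)"
    by (rule sum_mono, rule sum_mono, rule term_le)
  also have "(\<Sum>k\<in>A. \<Sum>l\<in>A. (if k = l then g k k * (\<xi> k)\<^sup>2 else 0) - h k l * ((\<xi> k)\<^sup>2 + (\<xi> l)\<^sup>2) / 2)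
      = (\<Sum>k\<in>A. g k k * (\<xi> k)\<^sup>2) - ((\<Sum>k\<in>A. \<Sum>l\<in>A. h k l * (\<xi> k)\<^sup>2) + (\<Sum>k\<in>A. \<Sum>l\<in>A. h k l * (\<xi> l)\<^sup>2)) / 2"
  proof -
    have "(\<Sum>l\<in>A. if k = l then g k k * (\<xi> k)\<^sup>2 else 0) = g k k * (\<xi> k)\<^sup>2" if "k \<in> A" for k
      using \<open>finite A\<close> that by simp
    then show ?thesis
      by (simp add: sum_subtractf sum.distrib sum_divide_distrib distrib_left add_divide_distrib cong: sum.cong)
  qed
  also have "(\<Sum>k\<in>A. \<Sum>l\<in>A. h k l * (\<xi> l)\<^sup>2) = (\<Sum>k\<in>A. \<Sum>l\<in>A. h k l * (\<xi> k)\<^sup>2)"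
    by (subst sum.swap) (intro sum.cong refl, auto simp: h_def sym)
  also have "(\<Sum>k\<in>A. \<Sum>l\<in>A. h k l * (\<xi> k)\<^sup>2) = (\<Sum>k\<in>A. (\<Sum>l\<in>A. h k l) * (\<xi> k)\<^sup>2)"
    by (simp add: sum_distrib_right)
  finally have "(\<Sum>k\<in>A. g k k * (\<xi> k)\<^sup>2) - (\<Sum>k\<in>A. (\<Sum>l\<in>A. h k l) * (\<xi> k)\<^sup>2) \<le> (\<Sum>k\<in>A. \<Sum>l\<in>A. \<xi> k * \<xi> l * g k l)"
    by simp
  moreover have "(\<Sum>k\<in>A. c * (\<xi> k)\<^sup>2) \<le> (\<Sum>k\<in>A. g k k * (\<xi> k)\<^sup>2 - (\<Sum>l\<in>A. h k l) * (\<xi> k)\<^sup>2)"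
  proof (rule sum_mono)
    fix k assume "k \<in> A"
    have "0 \<le> (g k k - c - (\<Sum>l\<in>A. h k l)) * (\<xi> k)\<^sup>2" using hsum[OF \<open>k \<in> A\<close>] by simp
    then show "c * (\<xi> k)\<^sup>2 \<le> g k k * (\<xi> k)\<^sup>2 - (\<Sum>l\<in>A. h k l) * (\<xi> k)\<^sup>2" by (simp add: algebra_simps)
  qed
  ultimately show ?thesis by (simp add: sum_subtractf sum_distrib_left)
qed

text \<open>\<open>- r d\<close> is the covariance of two unit increments at lag \<open>d\<close>.
  Twice \<open>r d\<close> is a decrement of the first differences \<open>D\<close>, so the sum over
  the lags from 2 on telescopes to at most \<open>D 2 = 2 powr a - 1\<close>; half of this falls on
  each side of \<open>k\<close>. Starting at lag 1 would give the bound 1, too weak for strict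
  dominance.\<close>

lemma sum_even_second_differences_le:
  fixes a :: real
  assumes a: "0 < a" "a < 1" and "k < n"
  defines "r \<equiv> \<lambda>d::nat. (2 * real d powr a - (real d + 1) powr a - (real d - 1) powr a) / 2"
  shows "(\<Sum>l\<in>{..<n} - {k}. \<bar>r (2 * (if k < l then l - k else k - l))\<bar>) \<le> 2 powr a - 1"
proof -
  have r0: "0 \<le> r d" if "2 \<le> d" for d
    using powr_second_difference_nonpos[of a "real d"] a that by (simp add: r_def)
  define D where "D m = real m powr a - real (m - 1) powr a" for m
  have r_eq: "2 * r d = D d - D (Suc d)" if "1 \<le> d" for d
    using that by (simp add: r_def D_def of_nat_diff add.commute)
  have Dpos: "0 \<le> D m" for m
    using a by (simp add: D_def powr_mono2)
  have tele: "(\<Sum>d=2..N. 2 * r d) \<le> 2 powr a - 1" for N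
  proof -
    have "(\<Sum>d=2..N. 2 * r d) \<le> D 2 - 0"
    proof (cases "2 \<le> N")
      case True
      have "(\<Sum>d=2..N. 2 * r d) = (\<Sum>d=2..N. D d - D (Suc d))" by (intro sum.cong r_eq) auto
      also have "\<dots> = D 2 - D (Suc N)" using sum_telescope''[of 2 N "\<lambda>d. - D d"] True
        by (simp add: sum_Suc_diff[of 2 N "\<lambda>d. - D d", simplified])
      finally show ?thesis using Dpos[of "Suc N"] by simp
    qed (use Dpos[of 2] in simp)
    then show ?thesis by (simp add: D_def)
  qed
  \<comment> \<open>Even lags are among all lags from 2 on, and the terms added are
    nonnegative.\<close>
  have half: "(\<Sum>j\<in>J. r (2 * j)) \<le> (2 powr a - 1) / 2" if "finite J" "\<And>j. j \<in> J \<Longrightarrow> 1 \<le> j" for J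
  proof -
    have "(\<Sum>j\<in>J. r (2 * j)) = (\<Sum>d\<in>(\<lambda>j. 2 * j) ` J. r d)"
      by (simp add: sum.reindex inj_on_def)
    also have "\<dots> \<le> (\<Sum>d=2..2 * Max (insert 0 J). r d)"
    proof (rule sum_mono2)
      show "(\<lambda>j. 2 * j) ` J \<subseteq> {2..2 * Max (insert 0 J)}"
        using that by (force intro!: Max_ge)
    qed (use r0 in auto)
    finally show ?thesis using tele[of "2 * Max (insert 0 J)"] by (simp add: sum_distrib_left[symmetric])
  qed
  have "(\<Sum>l\<in>{..<n} - {k}. \<bar>r (2 * (if k < l then l - k else k - l))\<bar>)
      = (\<Sum>l\<in>{..<k}. \<bar>r (2 * (k - l))\<bar>) + (\<Sum>l\<in>{k<..<n}. \<bar>r (2 * (l - k))\<bar>)"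
  proof -
    have split: "{..<n} - {k} = {..<k} \<union> {k<..<n}" using \<open>k < n\<close> by auto
    have "(\<Sum>l\<in>{..<n} - {k}. \<bar>r (2 * (if k < l then l - k else k - l))\<bar>)
        = (\<Sum>l\<in>{..<k}. \<bar>r (2 * (if k < l then l - k else k - l))\<bar>)
        + (\<Sum>l\<in>{k<..<n}. \<bar>r (2 * (if k < l then l - k else k - l))\<bar>)"
      unfolding split by (rule sum.union_disjoint) auto
    also have "\<dots> = (\<Sum>l\<in>{..<k}. \<bar>r (2 * (k - l))\<bar>) + (\<Sum>l\<in>{k<..<n}. \<bar>r (2 * (l - k))\<bar>)"
      by (intro arg_cong2[where f = "(+)"]; intro sum.cong) auto
    finally show ?thesis .
  qed
  also have "(\<Sum>l\<in>{..<k}. \<bar>r (2 * (k - l))\<bar>) = (\<Sum>j\<in>{1..k}. r (2 * j))"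
    by (rule sum.reindex_bij_witness[of _ "\<lambda>j. k - j" "\<lambda>l. k - l"]) (auto intro!: r0 abs_of_nonneg[symmetric])
  also have "(\<Sum>l\<in>{k<..<n}. \<bar>r (2 * (l - k))\<bar>) = (\<Sum>j\<in>{1..<n - k}. r (2 * j))"
    by (rule sum.reindex_bij_witness[of _ "\<lambda>j. k + j" "\<lambda>l. l - k"]) (auto intro!: r0 abs_of_nonneg[symmetric])
  also have "(\<Sum>j\<in>{1..k}. r (2 * j)) + (\<Sum>j\<in>{1..<n - k}. r (2 * j)) \<le> (2 powr a - 1) / 2 + (2 powr a - 1) / 2"
    by (intro add_mono half) auto
  finally show ?thesis by simp
qed

text \<open>The integrand times the standard density is a multiple of the centered normal density of
  variance \<open>1 / (1 + b)\<close>; the multiple, which is its standard deviation, is the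
  integral.\<close>

lemma std_normal_exp_square:
  assumes "0 \<le> b"
  shows "(LINT x|std_normal_distribution. exp (- (b * x\<^sup>2) / 2)) = 1 / sqrt (1 + b)"
proof -
  define \<sigma> where "\<sigma> = 1 / sqrt (1 + b)"
  have \<sigma>: "0 < \<sigma>" "\<sigma>\<^sup>2 = 1 / (1 + b)" using assms by (auto simp: \<sigma>_def power_divide)
  have eq: "std_normal_density x * exp (- (b * x\<^sup>2) / 2) = \<sigma> * normal_density 0 \<sigma> x" for x
  proof -
    have "normal_density 0 \<sigma> x = 1 / (sqrt (2 * pi) * \<sigma>) * exp (- (x\<^sup>2 * (1 + b)) / 2)"
    proof -
      have "sqrt (2 * pi * \<sigma>\<^sup>2) = sqrt (2 * pi) * \<sigma>" using \<sigma>(1) by (simp add: real_sqrt_mult)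
      moreover have "(x - 0)\<^sup>2 / (2 * \<sigma>\<^sup>2) = x\<^sup>2 * (1 + b) / 2" by (simp add: \<sigma>(2))
      ultimately show ?thesis by (simp only: normal_density_def minus_divide_left[symmetric])
    qed
    moreover have "exp (- x\<^sup>2 / 2) * exp (- (b * x\<^sup>2) / 2) = exp (- (x\<^sup>2 * (1 + b)) / 2)"
      by (simp add: mult_exp_exp algebra_simps add_divide_distrib diff_divide_distrib)
    ultimately show ?thesis using \<sigma>(1) by (simp add: std_normal_density_def)
  qed
  have "(LINT x|std_normal_distribution. exp (- (b * x\<^sup>2) / 2)) = (LINT x|lborel. std_normal_density x * exp (- (b * x\<^sup>2) / 2))"
    by (subst integral_density) auto
  also have "\<dots> = \<sigma>" unfolding eq using \<sigma>(1) by simp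
  finally show ?thesis by (simp add: \<sigma>_def)
qed

section \<open>Upper bound on the small ball probability\<close>

context prob_space
begin

text \<open>Diagonal dominance of the covariance matrix \<open>G\<close> of every second increment:
  its diagonal is \<open>u powr (2 * H)\<close>, the absolute row sums off it are at most
  \<open>2 powr (2 * H) - 1\<close> times that, and the margin \<open>2 - 2 powr (2 * H)\<close> is
  positive for \<open>H < 1 / 2\<close>.\<close>

lemma fbm_increments_variance_ge:
  assumes B: "fractional_brownian_motion H B" and H: "0 < H" "H < 1 / 2" and u: "0 < u"
  shows "(2 - 2 powr (2 * H)) * u powr (2 * H) * (\<Sum>k<n. (\<xi> k)\<^sup>2)
    \<le> expectation (\<lambda>\<omega>. (\<Sum>k<n. \<xi> k * (B (real (2 * k + 1) * u) \<omega> - B (real (2 * k) * u) \<omega>))\<^sup>2)"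
proof -
  define a where "a = 2 * H"
  have a: "0 < a" "a < 1" using H by (auto simp: a_def)
  define r where "r d = (2 * real d powr a - (real d + 1) powr a - (real d - 1) powr a) / 2" for d :: nat
  define \<Delta> where "\<Delta> k \<omega> = B (real (2 * k + 1) * u) \<omega> - B (real (2 * k) * u) \<omega>" for k \<omega>
  define G where "G k l = u powr a * (if k = l then 1 else - r (2 * (if k < l then l - k else k - l)))" for k l :: nat
  have "0 \<le> real m * u" for m using u by simp
  note inc = fbm_increment_product[OF B this this this this]
  have int: "integrable M (\<lambda>\<omega>. \<Delta> k \<omega> * \<Delta> l \<omega>)" for k l
    unfolding \<Delta>_def by (rule inc(1))
  have lag: "1 / 2 * (\<bar>real (2 * k + 1) * u - real (2 * l) * u\<bar> powr a + \<bar>real (2 * k) * u - real (2 * l + 1) * u\<bar> powr a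
        - \<bar>real (2 * k + 1) * u - real (2 * l + 1) * u\<bar> powr a - \<bar>real (2 * k) * u - real (2 * l) * u\<bar> powr a)
      = u powr a * - r (2 * (l - k))" if "k < l" for k l
  proof -
    define d where "d = real (2 * (l - k))"
    have d: "2 \<le> d" "real (2 * l) = real (2 * k) + d" using that by (auto simp: d_def of_nat_diff)
    have "\<bar>real (2 * k + 1) * u - real (2 * l) * u\<bar> = (d - 1) * u"
      "\<bar>real (2 * k) * u - real (2 * l + 1) * u\<bar> = (d + 1) * u"
      "\<bar>real (2 * k + 1) * u - real (2 * l + 1) * u\<bar> = d * u"
      "\<bar>real (2 * k) * u - real (2 * l) * u\<bar> = d * u"
      using u d by (auto simp: abs_mult left_diff_distrib[symmetric])
    then show ?thesis
      using u d(1) by (simp only: r_def d_def[symmetric] powr_mult) (simp add: field_simps)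
  qed
  have cov: "expectation (\<lambda>\<omega>. \<Delta> k \<omega> * \<Delta> l \<omega>) = G k l" for k l
  proof -
    consider "k = l" | "k < l" | "l < k" by linarith
    then show ?thesis
    proof cases
      case 1
      have "expectation (\<lambda>\<omega>. \<Delta> k \<omega> * \<Delta> k \<omega>) = u powr a"
        unfolding \<Delta>_def inc(2) a_def using u by (simp add: left_diff_distrib[symmetric])
      then show ?thesis using 1 by (simp add: G_def)
    next
      case 2
      then show ?thesis
        using lag[OF 2] unfolding \<Delta>_def inc(2) a_def[symmetric] by (simp add: G_def)
    next
      case 3
      have "expectation (\<lambda>\<omega>. \<Delta> k \<omega> * \<Delta> l \<omega>) = expectation (\<lambda>\<omega>. \<Delta> l \<omega> * \<Delta> k \<omega>)"
        by (simp add: mult.commute)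
      then show ?thesis
        using 3 lag[OF 3] unfolding \<Delta>_def inc(2) a_def[symmetric] by (simp add: G_def)
    qed
  qed
  have "(2 - 2 powr a) * u powr a * (\<Sum>k<n. (\<xi> k)\<^sup>2) \<le> (\<Sum>k<n. \<Sum>l<n. \<xi> k * \<xi> l * G k l)"
  proof (rule diagonally_dominant_quadratic_form)
    show "G k l = G l k" for k l by (simp add: G_def)
    fix k assume "k \<in> {..<n}"
    have "(\<Sum>l\<in>{..<n} - {k}. \<bar>G k l\<bar>) = u powr a * (\<Sum>l\<in>{..<n} - {k}. \<bar>r (2 * (if k < l then l - k else k - l))\<bar>)"
      unfolding sum_distrib_left by (intro sum.cong) (auto simp: G_def abs_mult)
    also have "\<dots> \<le> u powr a * (2 powr a - 1)"
      using sum_even_second_differences_le[OF a, of k n] \<open>k \<in> {..<n}\<close>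
      by (intro mult_left_mono) (auto simp: r_def)
    finally show "(\<Sum>l\<in>{..<n} - {k}. \<bar>G k l\<bar>) \<le> G k k - (2 - 2 powr a) * u powr a"
      by (simp add: G_def algebra_simps)
  qed simp
  also have "\<dots> = (\<Sum>k<n. \<Sum>l<n. expectation (\<lambda>\<omega>. \<xi> k * \<xi> l * (\<Delta> k \<omega> * \<Delta> l \<omega>)))"
    by (simp add: cov)
  also have "\<dots> = expectation (\<lambda>\<omega>. \<Sum>k<n. \<Sum>l<n. \<xi> k * \<xi> l * (\<Delta> k \<omega> * \<Delta> l \<omega>))"
    using int by (simp add: Bochner_Integration.integral_sum)
  also have "(\<lambda>\<omega>. \<Sum>k<n. \<Sum>l<n. \<xi> k * \<xi> l * (\<Delta> k \<omega> * \<Delta> l \<omega>)) = (\<lambda>\<omega>. (\<Sum>k<n. \<xi> k * \<Delta> k \<omega>)\<^sup>2)"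
    by (simp add: power2_eq_square sum_product mult_ac)
  finally show ?thesis unfolding a_def \<Delta>_def .
qed

text \<open>The characteristic function factorises by independence; the Wiener factor has modulus at
  most 1, and the other factor is controlled by the variance bound.\<close>

lemma mixed_increments_iexp_le:
  assumes B: "fractional_brownian_motion H B" and H: "0 < H" "H < 1 / 2" and u: "0 < u"
    and ind: "independent_processes B W"
  shows "norm (expectation (\<lambda>\<omega>. iexp (\<Sum>k<n. \<xi> k *
      ((B (real (2 * k + 1) * u) \<omega> - B (real (2 * k) * u) \<omega>) + (W (real (2 * k + 1) * u) \<omega> - W (real (2 * k) * u) \<omega>)))))
    \<le> exp (- ((2 - 2 powr (2 * H)) * u powr (2 * H) * (\<Sum>k<n. (\<xi> k)\<^sup>2)) / 2)"
proof -
  \<comment> \<open>The Boolean tells the two end points of an increment apart, so that a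
    combination of increments becomes one of values, with the signs in \<open>c\<close>.\<close>
  define A where "A = {..<n} \<times> (UNIV :: bool set)"
  define f where "f = (\<lambda>(k, b). if b then real (2 * k + 1) * u else real (2 * k) * u)"
  define c where "c = (\<lambda>(k, b). if b then \<xi> k else - \<xi> k)"
  have A: "finite A" by (simp add: A_def)
  have f: "0 \<le> f i" for i using u by (auto simp: f_def split: prod.splits)
  have sum: "(\<Sum>i\<in>A. c i * Z (f i) \<omega>) = (\<Sum>k<n. \<xi> k * (Z (real (2 * k + 1) * u) \<omega> - Z (real (2 * k) * u) \<omega>))"
    for Z :: "real \<Rightarrow> 'a \<Rightarrow> real" and \<omega>
    unfolding A_def sum.cartesian_product'
    by (simp add: UNIV_bool c_def f_def right_diff_distrib)
  have "expectation (\<lambda>\<omega>. iexp (\<Sum>k<n. \<xi> k *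
      ((B (real (2 * k + 1) * u) \<omega> - B (real (2 * k) * u) \<omega>) + (W (real (2 * k + 1) * u) \<omega> - W (real (2 * k) * u) \<omega>))))
    = expectation (\<lambda>\<omega>. iexp ((\<Sum>i\<in>A. c i * B (f i) \<omega>) + (\<Sum>i\<in>A. c i * W (f i) \<omega>)))"
    unfolding sum by (simp only: distrib_left sum.distrib)
  also have "\<dots> = expectation (\<lambda>\<omega>. iexp (\<Sum>i\<in>A. c i * B (f i) \<omega>)) * expectation (\<lambda>\<omega>. iexp (\<Sum>i\<in>A. c i * W (f i) \<omega>))"
    by (rule independent_sum_iexp[OF ind A f A f])
  also have "norm \<dots> \<le> norm (expectation (\<lambda>\<omega>. iexp (\<Sum>i\<in>A. c i * B (f i) \<omega>))) * 1"
    unfolding norm_mult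
  proof (rule mult_left_mono)
    have "norm (expectation (\<lambda>\<omega>. iexp (\<Sum>i\<in>A. c i * W (f i) \<omega>))) \<le> expectation (\<lambda>\<omega>. norm (iexp (\<Sum>i\<in>A. c i * W (f i) \<omega>)))"
      by (rule integral_norm_bound)
    then show "norm (expectation (\<lambda>\<omega>. iexp (\<Sum>i\<in>A. c i * W (f i) \<omega>))) \<le> 1"
      by (simp add: prob_space del: of_real_sum of_real_mult)
  qed simp
  also have "\<dots> = exp (- expectation (\<lambda>\<omega>. (\<Sum>i\<in>A. c i * B (f i) \<omega>)\<^sup>2) / 2)"
    unfolding fbm_sum_iexp[OF B A f] by (simp del: of_real_exp)
  also have "\<dots> \<le> exp (- ((2 - 2 powr (2 * H)) * u powr (2 * H) * (\<Sum>k<n. (\<xi> k)\<^sup>2)) / 2)"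
    using fbm_increments_variance_ge[OF B H u, where n = n and \<xi> = \<xi>] by (simp add: sum)
  finally show ?thesis .
qed

text \<open>\<open>exp (- z\<^sup>2 / 2)\<close> is the standard normal characteristic function at
  \<open>z\<close>. Inserting it for each \<open>Z k\<close> and exchanging the integrals produces
  the joint characteristic function of the \<open>Z k\<close>, averaged over normal frequencies; the
  assumed bound on it is a product, so its average factorises.\<close>

lemma exp_neg_sum_squares_le:
  fixes Z :: "nat \<Rightarrow> 'a \<Rightarrow> real"
  assumes Z: "\<And>k. k < n \<Longrightarrow> random_variable borel (Z k)" and b: "0 \<le> b"
    and char: "\<And>\<xi>. norm (expectation (\<lambda>\<omega>. iexp (\<Sum>k<n. \<xi> k * Z k \<omega>))) \<le> exp (- (b * (\<Sum>k<n. (\<xi> k)\<^sup>2)) / 2)"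
  shows "expectation (\<lambda>\<omega>. exp (- (\<Sum>k<n. (Z k \<omega>)\<^sup>2) / 2)) \<le> (1 / sqrt (1 + b)) ^ n"
proof -
  interpret N: real_distribution std_normal_distribution by (rule real_dist_normal_dist)
  interpret PS: product_prob_space "\<lambda>_::nat. std_normal_distribution" "{..<n}" ..
  define P where "P = (\<Pi>\<^sub>M k\<in>{..<n}. std_normal_distribution)"
  interpret P: prob_space P unfolding P_def by (rule PS.prob_space_axioms)
  interpret MP: pair_prob_space M P ..
  have [measurable]: "Z k \<in> borel_measurable M" if "k \<in> {..<n}" for k using Z that by auto
  have [measurable]: "(\<lambda>\<xi>. \<xi> k) \<in> borel_measurable P" if "k \<in> {..<n}" for k
    using measurable_component_singleton[of k "{..<n}" "\<lambda>_. std_normal_distribution"] that by (simp add: P_def)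
  define S where "S \<omega> \<xi> = (\<Sum>k<n. \<xi> k * Z k \<omega>)" for \<omega> and \<xi> :: "nat \<Rightarrow> real"
  have [measurable]: "(\<lambda>z. S (fst z) (snd z)) \<in> borel_measurable (M \<Otimes>\<^sub>M P)"
    unfolding S_def by measurable
  have inner: "(CLINT \<xi>|P. iexp (S \<omega> \<xi>)) = of_real (exp (- (\<Sum>k<n. (Z k \<omega>)\<^sup>2) / 2))" for \<omega>
  proof -
    have "iexp (S \<omega> \<xi>) = (\<Prod>k<n. iexp (Z k \<omega> * \<xi> k))" for \<xi>
      by (simp add: S_def exp_sum sum_distrib_left mult_ac)
    then have "(CLINT \<xi>|P. iexp (S \<omega> \<xi>)) = (\<Prod>k<n. (CLINT x|std_normal_distribution. iexp (Z k \<omega> * x)))"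
      unfolding P_def by (simp only:) (intro PS.product_integral_prod, auto intro!: N.integrable_iexp)
    also have "\<dots> = (\<Prod>k<n. char std_normal_distribution (Z k \<omega>))" by (simp add: char_def)
    also have "\<dots> = of_real (exp (\<Sum>k<n. - (Z k \<omega>)\<^sup>2 / 2))"
      by (simp add: char_std_normal_distribution exp_sum)
    finally show ?thesis by (simp only: sum_divide_distrib[symmetric] sum_negf)
  qed
  have "of_real (expectation (\<lambda>\<omega>. exp (- (\<Sum>k<n. (Z k \<omega>)\<^sup>2) / 2))) = (CLINT \<omega>|M. CLINT \<xi>|P. iexp (S \<omega> \<xi>))"
    unfolding inner by simp
  also have "\<dots> = (CLINT \<xi>|P. CLINT \<omega>|M. iexp (S \<omega> \<xi>))"
  proof (rule MP.Fubini_integral[symmetric])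
    show "integrable (M \<Otimes>\<^sub>M P) (\<lambda>(\<omega>, \<xi>). iexp (S \<omega> \<xi>))"
      unfolding case_prod_unfold by (rule MP.integrable_const_bound[where B = 1]) auto
  qed
  finally have "expectation (\<lambda>\<omega>. exp (- (\<Sum>k<n. (Z k \<omega>)\<^sup>2) / 2)) \<le> norm (CLINT \<xi>|P. CLINT \<omega>|M. iexp (S \<omega> \<xi>))"
    by (metis abs_ge_self norm_of_real)
  also have "\<dots> \<le> (LINT \<xi>|P. norm (CLINT \<omega>|M. iexp (S \<omega> \<xi>)))"
    by (rule integral_norm_bound)
  also have "\<dots> \<le> (LINT \<xi>|P. (\<Prod>k<n. exp (- (b * (\<xi> k)\<^sup>2) / 2)))"
  proof (rule integral_mono')
    show "integrable P (\<lambda>\<xi>. \<Prod>k<n. exp (- (b * (\<xi> k)\<^sup>2) / 2))"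
      using b by (intro P.integrable_const_bound[where B = 1]) (auto intro!: prod_le_1 simp: abs_prod)
    show "norm (CLINT \<omega>|M. iexp (S \<omega> \<xi>)) \<le> (\<Prod>k<n. exp (- (b * (\<xi> k)\<^sup>2) / 2))" for \<xi>
      using char[of \<xi>] by (simp add: S_def sum_distrib_left sum_divide_distrib sum_negf flip: exp_sum)
  qed (auto intro!: prod_nonneg)
  also have "\<dots> = (\<Prod>k<n. (LINT x|std_normal_distribution. exp (- (b * x\<^sup>2) / 2)))"
    unfolding P_def using b
    by (intro PS.product_integral_prod N.integrable_const_bound[where B = 1]) auto
  also have "\<dots> = (1 / sqrt (1 + b)) ^ n" using std_normal_exp_square[OF b] by simp
  finally show ?thesis .
qed


text \<open>On the small ball event every normalised increment is at most 2 in absolute value, so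
  the random variable \<open>Y\<close> averaged here is at least \<open>exp (- 2 * n)\<close> there.
  Dividing by this costs a factor \<open>exp 2\<close> per increment.\<close>

lemma mixed_small_ball_le:
  assumes B: "fractional_brownian_motion H B" and H: "0 < H" "H < 1 / 2"
    and W: "wiener_process W" and ind: "independent_processes B W"
    and T: "0 < T" and \<epsilon>: "0 < \<epsilon>" and u: "0 < u" "2 * real n * u \<le> T"
  shows "small_ball_prob T (\<lambda>t \<omega>. B t \<omega> + W t \<omega>) \<epsilon>
    \<le> (exp 2 / sqrt (1 + (2 - 2 powr (2 * H)) * u powr (2 * H) / \<epsilon>\<^sup>2)) ^ n"
proof -
  define X where "X t \<omega> = B t \<omega> + W t \<omega>" for t \<omega>
  define Z where "Z k \<omega> = (X (real (2 * k + 1) * u) \<omega> - X (real (2 * k) * u) \<omega>) / \<epsilon>" for k \<omega>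
  define b where "b = (2 - 2 powr (2 * H)) * u powr (2 * H) / \<epsilon>\<^sup>2"
  have "2 powr (2 * H) \<le> 2 powr (1 :: real)" using H by (intro powr_mono) auto
  then have b: "0 \<le> b" by (simp add: b_def)
  have rvB: "random_variable borel (B t)" and rvW: "random_variable borel (W t)" if "0 \<le> t" for t
    using fbm_facts(2)[OF B that] W that by (auto simp: wiener_process_def)
  have X: "random_variable borel (X t)" if "0 \<le> t" for t
    using rvB[OF that] rvW[OF that] unfolding X_def[abs_def] by (rule borel_measurable_add)
  have Z: "random_variable borel (Z k)" for k
    unfolding Z_def[abs_def] using X u(1) by (intro borel_measurable_divide borel_measurable_diff) auto
  have cont: "continuous_paths M X"
    using fbm_facts(7)[OF B] W unfolding X_def wiener_process_def continuous_paths_def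
    by (auto intro!: continuous_intros)
  have char: "norm (expectation (\<lambda>\<omega>. iexp (\<Sum>k<n. \<xi> k * Z k \<omega>))) \<le> exp (- (b * (\<Sum>k<n. (\<xi> k)\<^sup>2)) / 2)" for \<xi>
  proof -
    have eq: "\<xi> k * Z k \<omega> = \<xi> k / \<epsilon> * ((B (real (2 * k + 1) * u) \<omega> - B (real (2 * k) * u) \<omega>) +
        (W (real (2 * k + 1) * u) \<omega> - W (real (2 * k) * u) \<omega>))" for k \<omega>
      by (simp add: Z_def X_def)
    have "norm (expectation (\<lambda>\<omega>. iexp (\<Sum>k<n. \<xi> k * Z k \<omega>)))
        \<le> exp (- ((2 - 2 powr (2 * H)) * u powr (2 * H) * (\<Sum>k<n. (\<xi> k / \<epsilon>)\<^sup>2)) / 2)"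
      unfolding eq by (rule mixed_increments_iexp_le[OF B H u(1) ind])
    also have "(2 - 2 powr (2 * H)) * u powr (2 * H) * (\<Sum>k<n. (\<xi> k / \<epsilon>)\<^sup>2) = b * (\<Sum>k<n. (\<xi> k)\<^sup>2)"
      by (simp add: b_def power_divide sum_divide_distrib[symmetric])
    finally show ?thesis .
  qed
  define Y where "Y \<omega> = exp (- (\<Sum>k<n. (Z k \<omega>)\<^sup>2) / 2)" for \<omega>
  have [measurable]: "Z k \<in> borel_measurable M" for k by (rule Z)
  have Ym: "Y \<in> borel_measurable M" unfolding Y_def by measurable
  have Yint: "integrable M Y"
    by (rule integrable_const_bound[where B = 1]) (use Ym in \<open>auto simp: Y_def sum_nonneg\<close>)
  define E where "E = {\<omega> \<in> space M. (SUP t\<in>{0..T}. \<bar>X t \<omega>\<bar>) \<le> \<epsilon>}"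
  have Esets: "E \<in> events"
    unfolding E_def using X cont T by (intro small_ball_event(3)[where \<delta> = T and N = 1]) auto
  have low: "indicator E \<omega> * exp (- 2 * real n) \<le> Y \<omega>" if "\<omega> \<in> space M" for \<omega>
  proof (cases "\<omega> \<in> E")
    case True
    have "continuous_on {0..T} (\<lambda>t. X t \<omega>)"
      using cont that unfolding continuous_paths_def by (auto intro: continuous_on_subset)
    then have "bdd_above ((\<lambda>t. \<bar>X t \<omega>\<bar>) ` {0..T})"
      by (intro bounded_imp_bdd_above compact_imp_bounded compact_continuous_image continuous_intros) auto
    then have Xle: "\<bar>X t \<omega>\<bar> \<le> \<epsilon>" if "t \<in> {0..T}" for t
      using cSUP_upper[OF that] True unfolding E_def by force
    have "(Z k \<omega>)\<^sup>2 \<le> 4" if "k < n" for k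
    proof -
      have le: "real (2 * k + 1) * u \<le> 2 * real n * u" "real (2 * k) * u \<le> 2 * real n * u"
        using that u(1) by (auto intro!: mult_right_mono)
      have "real (2 * k + 1) * u \<in> {0..T}" "real (2 * k) * u \<in> {0..T}"
        using order_trans[OF le(1) u(2)] order_trans[OF le(2) u(2)] u(1) by simp_all
      then have "\<bar>X (real (2 * k + 1) * u) \<omega>\<bar> \<le> \<epsilon>" "\<bar>X (real (2 * k) * u) \<omega>\<bar> \<le> \<epsilon>"
        using Xle by blast+
      then have "\<bar>Z k \<omega>\<bar> \<le> 2" using \<epsilon> by (simp add: Z_def pos_divide_le_eq)
      then have "\<bar>Z k \<omega>\<bar>\<^sup>2 \<le> 2\<^sup>2" by (intro power_mono) auto
      then show ?thesis by simp
    qed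
    then have "(\<Sum>k<n. (Z k \<omega>)\<^sup>2) \<le> (\<Sum>k<n. 4)" by (intro sum_mono) auto
    then show ?thesis using True by (simp add: Y_def)
  qed (simp add: Y_def)
  have "prob E * exp (- 2 * real n) = expectation (\<lambda>\<omega>. indicator E \<omega> * exp (- 2 * real n))"
    using Esets by simp
  also have "\<dots> \<le> expectation Y"
  proof (rule integral_mono[OF _ Yint low])
    show "integrable M (\<lambda>\<omega>. indicator E \<omega> * exp (- 2 * real n))"
      using Esets by (intro integrable_const_bound[where B = 1]) (auto simp: indicator_def)
  qed
  also have "\<dots> \<le> (1 / sqrt (1 + b)) ^ n"
    unfolding Y_def using Z b char by (rule exp_neg_sum_squares_le)
  finally have "prob E * exp (- 2 * real n) * exp (2 * real n) \<le> (1 / sqrt (1 + b)) ^ n * exp (2 * real n)"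
    by (rule mult_right_mono) simp
  moreover have "prob E * exp (- 2 * real n) * exp (2 * real n) = prob E"
    by (simp add: mult.assoc mult_exp_exp)
  moreover have "exp (2 * real n) = exp 2 ^ n" by (simp add: exp_of_nat_mult[symmetric] mult.commute)
  ultimately have "prob E \<le> (1 / sqrt (1 + b)) ^ n * exp 2 ^ n" by (simp only:)
  then have "prob E \<le> (exp 2 / sqrt (1 + b)) ^ n" by (simp add: power_divide)
  then show ?thesis unfolding small_ball_prob_def E_def X_def b_def .
qed

end

section \<open>Small deviations of the mixed process\<close>

context prob_space
begin

section \<open>Moments of the mixed increments\<close>

lemma wiener_increment_even_moment:
  assumes W: "wiener_process W" and "1 \<le> k" and st: "0 \<le> s" "0 \<le> t"
  shows "integrable M (\<lambda>\<omega>. (W s \<omega> - W t \<omega>) ^ (2 * k))"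
    and "expectation (\<lambda>\<omega>. (W s \<omega> - W t \<omega>) ^ (2 * k)) = \<bar>s - t\<bar> ^ k * (fact (2 * k) / (2 ^ k * fact k))"
proof -
  have less: "integrable M (\<lambda>\<omega>. (W b \<omega> - W a \<omega>) ^ (2 * k)) \<and>
      expectation (\<lambda>\<omega>. (W b \<omega> - W a \<omega>) ^ (2 * k)) = \<bar>b - a\<bar> ^ k * (fact (2 * k) / (2 ^ k * fact k))"
    if "0 \<le> a" "a < b" for a b
  proof -
    have "distributed M lborel (\<lambda>\<omega>. W b \<omega> - W a \<omega>) (normal_density 0 (sqrt (b - a)))"
      using W that by (simp add: wiener_process_def)
    from normal_even_moment[OF _ this] show ?thesis using that by simp
  qed
  have flip: "(W s \<omega> - W t \<omega>) ^ (2 * k) = (W t \<omega> - W s \<omega>) ^ (2 * k)" for \<omega>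
    by (simp add: power_mult power2_commute)
  have "integrable M (\<lambda>\<omega>. (W s \<omega> - W t \<omega>) ^ (2 * k)) \<and>
      expectation (\<lambda>\<omega>. (W s \<omega> - W t \<omega>) ^ (2 * k)) = \<bar>s - t\<bar> ^ k * (fact (2 * k) / (2 ^ k * fact k))"
  proof -
    consider "s < t" | "t < s" | "s = t" by linarith
    then show ?thesis
    proof cases
      case 1
      then show ?thesis using less[OF st(1) 1] unfolding flip by (simp add: abs_minus_commute)
    next
      case 2
      then show ?thesis using less[OF st(2) 2] by simp
    next
      case 3
      then show ?thesis using \<open>1 \<le> k\<close> by (simp add: power_0_left)
    qed
  qed
  then show "integrable M (\<lambda>\<omega>. (W s \<omega> - W t \<omega>) ^ (2 * k))"
    and "expectation (\<lambda>\<omega>. (W s \<omega> - W t \<omega>) ^ (2 * k)) = \<bar>s - t\<bar> ^ k * (fact (2 * k) / (2 ^ k * fact k))"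
    by auto
qed

lemma fbm_increment_even_moment:
  assumes B: "fractional_brownian_motion H B" and "1 \<le> k" and st: "0 \<le> s" "0 \<le> t"
  shows "integrable M (\<lambda>\<omega>. (B s \<omega> - B t \<omega>) ^ (2 * k))"
    and "expectation (\<lambda>\<omega>. (B s \<omega> - B t \<omega>) ^ (2 * k)) = (\<bar>s - t\<bar> powr (2 * H)) ^ k * (fact (2 * k) / (2 ^ k * fact k))"
proof -
  have "gaussian_variable (\<lambda>\<omega>. \<Sum>b\<in>(UNIV :: bool set). (if b then 1 else - 1) * B (if b then s else t) \<omega>)"
    using st by (intro gaussian_process_sum fbm_facts(1)[OF B]) auto
  then have g: "gaussian_variable (\<lambda>\<omega>. B s \<omega> - B t \<omega>)" by (simp add: UNIV_bool)
  have e: "expectation (\<lambda>\<omega>. B s \<omega> - B t \<omega>) = 0"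
    using fbm_facts(3,4)[OF B] st by simp
  have v: "expectation (\<lambda>\<omega>. (B s \<omega> - B t \<omega>)\<^sup>2) = \<bar>s - t\<bar> powr (2 * H)"
    using fbm_increment_product(2)[OF B st st] by (simp add: power2_eq_square abs_minus_commute)
  show "integrable M (\<lambda>\<omega>. (B s \<omega> - B t \<omega>) ^ (2 * k))"
    and "expectation (\<lambda>\<omega>. (B s \<omega> - B t \<omega>) ^ (2 * k)) = (\<bar>s - t\<bar> powr (2 * H)) ^ k * (fact (2 * k) / (2 ^ k * fact k))"
    using gaussian_variable_even_moment[OF g e \<open>1 \<le> k\<close>] unfolding v by auto
qed

text \<open>Since \<open>2 * H < 1\<close>, Wiener increments are of smaller order than fractional
  ones over short times: on \<open>{0..T}\<close> their moment of order
  \<open>\<bar>s - t\<bar> ^ k\<close> is at most \<open>T powr ((1 - 2 * H) * k)\<close> times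
  \<open>\<bar>s - t\<bar> powr (2 * H * k)\<close>, up to the common constant
  \<open>m\<close>.\<close>

lemma mixed_increment_moment:
  assumes B: "fractional_brownian_motion H B" and W: "wiener_process W" and H: "0 < H" "H < 1 / 2"
    and "0 < T" "1 \<le> k"
  obtains K where "0 \<le> K"
    and "\<And>s t. s \<in> {0..T} \<Longrightarrow> t \<in> {0..T} \<Longrightarrow>
      integrable M (\<lambda>\<omega>. \<bar>(B s \<omega> - B t \<omega>) + (W s \<omega> - W t \<omega>)\<bar> ^ (2 * k)) \<and>
      expectation (\<lambda>\<omega>. \<bar>(B s \<omega> - B t \<omega>) + (W s \<omega> - W t \<omega>)\<bar> ^ (2 * k)) \<le> K * \<bar>s - t\<bar> powr (H * (2 * k))"
proof -
  define m where "m = (fact (2 * k) / (2 ^ k * fact k) :: real)"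
  define K where "K = 2 ^ (2 * k) * (m * (1 + T powr ((1 - 2 * H) * k)))"
  have m: "0 \<le> m" by (simp add: m_def)
  show thesis
  proof (rule that[of K])
    show "0 \<le> K" using m by (simp add: K_def add_nonneg_nonneg)
    fix s t assume st: "s \<in> {0..T}" "t \<in> {0..T}"
    define F where "F \<omega> = \<bar>(B s \<omega> - B t \<omega>) + (W s \<omega> - W t \<omega>)\<bar> ^ (2 * k)" for \<omega>
    define G where "G \<omega> = 2 ^ (2 * k) * ((B s \<omega> - B t \<omega>) ^ (2 * k) + (W s \<omega> - W t \<omega>) ^ (2 * k))" for \<omega>
    have "0 \<le> s" "0 \<le> t" using st by auto
    note b = fbm_increment_even_moment[OF B \<open>1 \<le> k\<close> this] and w = wiener_increment_even_moment[OF W \<open>1 \<le> k\<close> this]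
    have FG: "F \<omega> \<le> G \<omega>" for \<omega>
    proof -
      define x y where "x = \<bar>B s \<omega> - B t \<omega>\<bar>" and "y = \<bar>W s \<omega> - W t \<omega>\<bar>"
      have "F \<omega> \<le> (x + y) ^ (2 * k)" unfolding F_def x_def y_def by (intro power_mono abs_triangle_ineq) auto
      also have "\<dots> \<le> (2 * max x y) ^ (2 * k)" 
        using max.cobounded1[of x y] max.cobounded2[of y x]
        by (intro power_mono) (linarith, simp add: x_def y_def)
      also have "\<dots> = 2 ^ (2 * k) * max x y ^ (2 * k)" by (simp add: power_mult_distrib)
      also have "\<dots> \<le> 2 ^ (2 * k) * (x ^ (2 * k) + y ^ (2 * k))"
        by (intro mult_left_mono) (auto simp: max_def x_def y_def)
      finally show ?thesis by (simp add: G_def x_def y_def power_even_abs)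
    qed
    have Gint: "integrable M G" unfolding G_def using b(1) w(1) by auto
    have [measurable]: "B s \<in> borel_measurable M" "B t \<in> borel_measurable M" "W s \<in> borel_measurable M" "W t \<in> borel_measurable M"
      using fbm_facts(2)[OF B] W \<open>0 \<le> s\<close> \<open>0 \<le> t\<close> by (auto simp: wiener_process_def)
    have Fm: "F \<in> borel_measurable M" unfolding F_def by measurable
    have F0: "0 \<le> F \<omega>" for \<omega> by (simp add: F_def)
    have Fint: "integrable M F"
      by (rule Bochner_Integration.integrable_bound[OF Gint Fm])
        (use FG F0 in \<open>simp add: abs_of_nonneg order_trans[OF FG abs_ge_self]\<close>)
    have "expectation F \<le> expectation G" by (intro integral_mono Fint Gint FG)
    also have "\<dots> = 2 ^ (2 * k) * ((\<bar>s - t\<bar> powr (2 * H)) ^ k * m + \<bar>s - t\<bar> ^ k * m)"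
      unfolding G_def using b w by (simp add: m_def)
    also have "\<dots> \<le> K * \<bar>s - t\<bar> powr (H * (2 * k))"
    proof (cases "s = t")
      case True
      then show ?thesis using \<open>1 \<le> k\<close> by (simp add: power_0_left)
    next
      case False
      define d where "d = \<bar>s - t\<bar>"
      have d: "0 < d" "d \<le> T" using False st by (auto simp: d_def)
      have 1: "(d powr (2 * H)) ^ k = d powr (H * (2 * k))"
        using d by (simp add: powr_realpow[symmetric] powr_powr mult_ac)
      have "d ^ k = d powr (H * (2 * k) + (1 - 2 * H) * k)"
        using d by (simp add: powr_realpow[symmetric] algebra_simps)
      also have "\<dots> = d powr (H * (2 * k)) * d powr ((1 - 2 * H) * k)" by (rule powr_add)
      also have "\<dots> \<le> d powr (H * (2 * k)) * T powr ((1 - 2 * H) * k)"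
        using d H by (intro mult_left_mono powr_mono2) auto
      finally have 2: "d ^ k \<le> d powr (H * (2 * k)) * T powr ((1 - 2 * H) * k)" .
      have "2 ^ (2 * k) * ((d powr (2 * H)) ^ k * m + d ^ k * m)
          \<le> 2 ^ (2 * k) * (d powr (H * (2 * k)) * m + (d powr (H * (2 * k)) * T powr ((1 - 2 * H) * k)) * m)"
        unfolding 1 using 2 m by (intro mult_left_mono add_left_mono mult_right_mono) auto
      also have "\<dots> = K * d powr (H * (2 * k))" by (simp add: K_def algebra_simps)
      finally show ?thesis unfolding d_def .
    qed
    finally show "integrable M (\<lambda>\<omega>. \<bar>(B s \<omega> - B t \<omega>) + (W s \<omega> - W t \<omega>)\<bar> ^ (2 * k)) \<and>
      expectation (\<lambda>\<omega>. \<bar>(B s \<omega> - B t \<omega>) + (W s \<omega> - W t \<omega>)\<bar> ^ (2 * k)) \<le> K * \<bar>s - t\<bar> powr (H * (2 * k))"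
      using Fint unfolding F_def by simp
  qed
qed

text \<open>Makes the exponent an explicit quadratic form in \<open>\<theta>\<close>, homogeneous of
  degree 2 as the symmetrization requires.\<close>

lemma mixed_grid_iexp:
  assumes B: "fractional_brownian_motion H B" and W: "wiener_process W" and ind: "independent_processes B W" and u: "0 < u"
  shows "expectation (\<lambda>\<omega>. iexp (\<Sum>k\<le>n. \<theta> k * ((B (real k * u) \<omega> - B 0 \<omega>) + (W (real k * u) \<omega> - W 0 \<omega>)))) =
    of_real (exp (- (expectation (\<lambda>\<omega>. (\<Sum>k\<le>n. \<theta> k * (B (real k * u) \<omega> - B 0 \<omega>))\<^sup>2) / 2
      + u * (\<Sum>j<n. (\<Sum>k=Suc j..n. \<theta> k)\<^sup>2) / 2)))"
proof -
  define A where "A = {..n} \<times> (UNIV :: bool set)"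
  define f where "f = (\<lambda>(k, b). if b then real k * u else 0)"
  define c where "c = (\<lambda>(k, b). if b then \<theta> k else - \<theta> k)"
  have A: "finite A" by (simp add: A_def)
  have f: "0 \<le> f i" for i using u by (auto simp: f_def split: prod.splits)
  have sum: "(\<Sum>i\<in>A. c i * Z (f i) \<omega>) = (\<Sum>k\<le>n. \<theta> k * (Z (real k * u) \<omega> - Z 0 \<omega>))"
    for Z :: "real \<Rightarrow> 'a \<Rightarrow> real" and \<omega>
    unfolding A_def sum.cartesian_product' by (simp add: UNIV_bool c_def f_def right_diff_distrib)
  have "expectation (\<lambda>\<omega>. iexp (\<Sum>k\<le>n. \<theta> k * ((B (real k * u) \<omega> - B 0 \<omega>) + (W (real k * u) \<omega> - W 0 \<omega>))))
    = expectation (\<lambda>\<omega>. iexp ((\<Sum>i\<in>A. c i * B (f i) \<omega>) + (\<Sum>i\<in>A. c i * W (f i) \<omega>)))"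
    unfolding sum by (simp only: distrib_left sum.distrib)
  also have "\<dots> = expectation (\<lambda>\<omega>. iexp (\<Sum>i\<in>A. c i * B (f i) \<omega>)) * expectation (\<lambda>\<omega>. iexp (\<Sum>i\<in>A. c i * W (f i) \<omega>))"
    by (rule independent_sum_iexp[OF ind A f A f])
  finally show ?thesis
    unfolding fbm_sum_iexp[OF B A f] unfolding sum wiener_sum_iexp[OF W u] of_real_mult[symmetric] mult_exp_exp
    by (simp only: minus_add_distrib minus_divide_left)
qed


section \<open>Matching the mesh to the radius of the ball\<close>

lemma mixed_measurable:
  assumes B: "fractional_brownian_motion H B" and W: "wiener_process W"
  shows "0 \<le> t \<Longrightarrow> random_variable borel (B t)" "0 \<le> t \<Longrightarrow> random_variable borel (W t)"
    and "continuous_paths M B" "continuous_paths M W"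
proof -
  show "random_variable borel (B t)" if "0 \<le> t" using fbm_facts(2)[OF B that] .
  show "random_variable borel (W t)" if "0 \<le> t" using W that by (simp add: wiener_process_def)
  show "continuous_paths M B" by (rule fbm_facts(7)[OF B])
  show "continuous_paths M W" using W by (simp add: wiener_process_def)
qed

text \<open>\<open>B 0\<close> and \<open>W 0\<close> vanish only almost surely, whereas the
  chaining starts from 0 at every outcome; this transfers the probability to the process with its
  initial values subtracted.\<close>

lemma small_ball_prob_cong_AE:
  assumes X: "\<And>t. 0 \<le> t \<Longrightarrow> random_variable borel (X t)" "continuous_paths M X"
    and Y: "\<And>t. 0 \<le> t \<Longrightarrow> random_variable borel (Y t)" "continuous_paths M Y"
    and "0 < T" and eq: "AE \<omega> in M. \<forall>t. X t \<omega> = Y t \<omega>"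
  shows "small_ball_prob T X \<epsilon> = small_ball_prob T Y \<epsilon>"
  unfolding small_ball_prob_def
proof (rule finite_measure_eq_AE)
  show "AE \<omega> in M. \<omega> \<in> {\<omega> \<in> space M. (SUP t\<in>{0..T}. \<bar>X t \<omega>\<bar>) \<le> \<epsilon>} \<longleftrightarrow>
      \<omega> \<in> {\<omega> \<in> space M. (SUP t\<in>{0..T}. \<bar>Y t \<omega>\<bar>) \<le> \<epsilon>}"
    using eq by eventually_elim simp
  show "{\<omega> \<in> space M. (SUP t\<in>{0..T}. \<bar>X t \<omega>\<bar>) \<le> \<epsilon>} \<in> events"
    using X \<open>0 < T\<close> by (intro small_ball_event(3)[where \<delta> = T and N = 1]) auto
  show "{\<omega> \<in> space M. (SUP t\<in>{0..T}. \<bar>Y t \<omega>\<bar>) \<le> \<epsilon>} \<in> events"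
    using Y \<open>0 < T\<close> by (intro small_ball_event(3)[where \<delta> = T and N = 1]) auto
qed

text \<open>A coarse mesh of order \<open>\<epsilon> powr (1 / H)\<close> satisfies
  \<open>\<delta> powr H \<le> \<epsilon>\<close>, and the number \<open>N\<close> of coarse cells,
  to which the exponent of the grid bound is proportional, is then of order
  \<open>\<epsilon> powr (- (1 / H))\<close>.\<close>

lemma mixed_small_ball_ge:
  assumes B: "fractional_brownian_motion H B" and W: "wiener_process W" and ind: "independent_processes B W"
    and H: "0 < H" "H < 1 / 2" and T: "0 < T"
  obtains C where "0 < C"
    and "\<And>\<epsilon>. 0 < \<epsilon> \<Longrightarrow> \<epsilon> \<le> T powr H \<Longrightarrow>
      exp (- (C * \<epsilon> powr (- (1 / H)))) \<le> small_ball_prob T (\<lambda>t \<omega>. B t \<omega> + W t \<omega>) \<epsilon>"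
proof -
  note m = mixed_measurable[OF B W]
  define X where "X t \<omega> = (B t \<omega> - B 0 \<omega>) + (W t \<omega> - W 0 \<omega>)" for t \<omega>
  have rv: "random_variable borel (X t)" if "0 \<le> t" for t
    unfolding X_def[abs_def] using m(1,2) that by (intro borel_measurable_add borel_measurable_diff) auto
  have cont: "continuous_paths M X"
    using m(3,4) unfolding X_def continuous_paths_def by (auto intro!: continuous_intros)
  have cong: "small_ball_prob T (\<lambda>t \<omega>. B t \<omega> + W t \<omega>) \<epsilon> = small_ball_prob T X \<epsilon>" for \<epsilon>
  proof (rule small_ball_prob_cong_AE[OF _ _ rv cont T])
    show "(\<lambda>\<omega>. B t \<omega> + W t \<omega>) \<in> borel_measurable M" if "0 \<le> t" for t
      using m(1,2) that by (intro borel_measurable_add) auto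
    show "continuous_paths M (\<lambda>t \<omega>. B t \<omega> + W t \<omega>)"
      using m(3,4) unfolding continuous_paths_def by (auto intro!: continuous_intros)
    have "AE \<omega> in M. W 0 \<omega> = 0" using W by (simp add: wiener_process_def)
    then show "AE \<omega> in M. \<forall>t. B t \<omega> + W t \<omega> = X t \<omega>"
      using fbm_zero[OF B] by eventually_elim (simp add: X_def)
  qed
  define q where "q u n \<theta> = expectation (\<lambda>\<omega>. (\<Sum>k\<le>n. \<theta> k * (B (real k * u) \<omega> - B 0 \<omega>))\<^sup>2) / 2
      + u * (\<Sum>j<n. (\<Sum>k=Suc j..n. \<theta> k)\<^sup>2) / 2" for u :: real and n and \<theta> :: "nat \<Rightarrow> real"
  have char: "expectation (\<lambda>\<omega>. iexp (\<Sum>k\<le>n. \<theta> k * X (real k * u) \<omega>)) = of_real (exp (- q u n \<theta>))"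
    if "0 < u" for u n \<theta>
    using mixed_grid_iexp[OF B W ind that] unfolding X_def q_def .
  have q: "q u n (\<lambda>k. r * \<theta> k) = r\<^sup>2 * q u n \<theta>" for u n r \<theta>
    by (simp add: q_def mult.assoc sum_distrib_left[symmetric] power_mult_distrib distrib_left)
  \<comment> \<open>Moments of order \<open>2 * k \<ge> 6 / H\<close>, which yield the decay
    \<open>1 / 8 ^ m\<close> in the chaining.\<close>
  define k where "k = nat \<lceil>3 / H\<rceil>"
  have "3 / H \<le> real k" unfolding k_def by linarith
  then have kH: "6 \<le> H * real (2 * k)" using H by (simp add: pos_divide_le_eq mult.commute)
  have k1: "1 \<le> k"
  proof (rule ccontr)
    assume "\<not> 1 \<le> k"
    then have "k = 0" by simp
    then show False using kH by simp
  qed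
  obtain K where K: "0 \<le> K"
    and mom: "\<And>s t. s \<in> {0..T} \<Longrightarrow> t \<in> {0..T} \<Longrightarrow>
      integrable M (\<lambda>\<omega>. \<bar>(B s \<omega> - B t \<omega>) + (W s \<omega> - W t \<omega>)\<bar> ^ (2 * k)) \<and>
      expectation (\<lambda>\<omega>. \<bar>(B s \<omega> - B t \<omega>) + (W s \<omega> - W t \<omega>)\<bar> ^ (2 * k)) \<le> K * \<bar>s - t\<bar> powr (H * (2 * k))"
    using mixed_increment_moment[OF B W H T k1] by blast
  have X_diff: "X s \<omega> - X t \<omega> = (B s \<omega> - B t \<omega>) + (W s \<omega> - W t \<omega>)" for s t \<omega>
    by (simp add: X_def)
  have momX: "integrable M (\<lambda>\<omega>. \<bar>X s \<omega> - X t \<omega>\<bar> ^ (2 * k)) \<and>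
      expectation (\<lambda>\<omega>. \<bar>X s \<omega> - X t \<omega>\<bar> ^ (2 * k)) \<le> K * \<bar>s - t\<bar> powr (H * real (2 * k))"
    if "s \<in> {0..T}" "t \<in> {0..T}" for s t
    using mom[OF that] unfolding X_diff by simp
  define A where "A = (2 / (1 - 2 powr (- H / 2))) ^ (2 * k) * K"
  have A: "0 \<le> A"
  proof -
    have "2 powr (- H / 2) \<le> 2 powr (0::real)" using H by (intro powr_mono) auto
    then show ?thesis using K by (simp add: A_def)
  qed
  \<comment> \<open>The summand \<open>ln 4\<close> absorbs the factor 1/4 of the grid bound, since
    \<open>N \<ge> 1\<close>.\<close>
  define D where "D = 20 + 12 * A + ln 4"
  have D: "0 < D" using A by (simp add: D_def add_pos_nonneg)
  show thesis
  proof (rule that[of "2 * T * D"])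
    show "0 < 2 * T * D" using T D by simp
    fix \<epsilon> :: real assume \<epsilon>: "0 < \<epsilon>" "\<epsilon> \<le> T powr H"
    define y where "y = \<epsilon> powr (- (1 / H))"
    have y: "0 < y" using \<epsilon> by (simp add: y_def)
    \<comment> \<open>The restriction \<open>\<epsilon> \<le> T powr H\<close> enters here: it makes
      rounding \<open>T * y\<close> up cost at most a factor 2.\<close>
    have Ty: "1 \<le> T * y"
    proof -
      have "\<epsilon> powr (1 / H) \<le> (T powr H) powr (1 / H)" using \<epsilon> H by (intro powr_mono2) auto
      then have "\<epsilon> powr (1 / H) \<le> T" using T H by (simp add: powr_powr)
      then show ?thesis using \<epsilon> by (simp add: y_def powr_minus divide_inverse[symmetric] pos_le_divide_eq)
    qed
    define N where "N = nat \<lceil>T * y\<rceil>"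
    have N: "T * y \<le> real N" "real N \<le> 2 * (T * y)" "0 < N"
    proof -
      show "T * y \<le> real N" unfolding N_def by linarith
      have "real N \<le> T * y + 1" using Ty unfolding N_def by linarith
      then show "real N \<le> 2 * (T * y)" using Ty by linarith
      show "0 < N" using Ty unfolding N_def by linarith
    qed
    define \<delta> where "\<delta> = T / real N"
    have \<delta>: "0 < \<delta>" "T = real N * \<delta>" using T N(3) by (auto simp: \<delta>_def)
    have "\<delta> powr H \<le> \<epsilon>"
    proof -
      have "\<delta> \<le> T / (T * y)" unfolding \<delta>_def using N T y by (intro divide_left_mono) auto
      also have "\<dots> = \<epsilon> powr (1 / H)" using T by (simp add: y_def powr_minus divide_inverse)
      finally have "\<delta> powr H \<le> (\<epsilon> powr (1 / H)) powr H" using \<delta>(1) H by (intro powr_mono2) auto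
      then show ?thesis using \<epsilon> H by (simp add: powr_powr)
    qed
    have X0: "X 0 \<omega> = 0" for \<omega> by (simp add: X_def)
    have p2: "1 \<le> 2 * k" using k1 by simp
    have grid: "exp (- real N * (20 + 12 * A)) / 4
        \<le> prob {\<omega> \<in> space M. \<forall>t\<in>(\<lambda>k. real k * \<delta> / 2 ^ R) ` {..N * 2 ^ R}. \<bar>X t \<omega>\<bar> \<le> \<epsilon>}" for R
      unfolding A_def
      by (rule grid_small_ball_ge[OF rv X0 char q momX p2 kH \<delta>(1) K \<epsilon>(1) \<open>\<delta> powr H \<le> \<epsilon>\<close> H(1) \<delta>(2) N(3)])
    have "exp (- (2 * T * D * y)) \<le> exp (- (real N * D))"
      using mult_right_mono[OF N(2), of D] D by (simp add: mult_ac)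
    also have "\<dots> \<le> exp (- real N * (20 + 12 * A) - ln 4)"
    proof -
      have "ln 4 \<le> real N * ln 4" using N(3) by simp
      then show ?thesis by (simp add: D_def algebra_simps)
    qed
    also have "\<dots> = exp (- real N * (20 + 12 * A)) / 4" by (simp add: exp_diff)
    also have "\<dots> \<le> small_ball_prob T X \<epsilon>"
      by (rule small_ball_ge_of_grid[OF rv cont \<delta> grid])
    finally show "exp (- (2 * T * D * \<epsilon> powr (- (1 / H)))) \<le> small_ball_prob T (\<lambda>t \<omega>. B t \<omega> + W t \<omega>) \<epsilon>"
      unfolding cong y_def .
  qed
qed

text \<open>The mesh is a multiple \<open>\<kappa>\<close> of
  \<open>\<epsilon> powr (1 / H)\<close>, large enough that the square root beats the loss
  \<open>exp 2\<close>; each of the \<open>n\<close> increments then contributes a factor at most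
  \<open>exp (- 1)\<close>.\<close>

lemma mixed_small_ball_exp_le:
  assumes B: "fractional_brownian_motion H B" and W: "wiener_process W" and ind: "independent_processes B W"
    and H: "0 < H" "H < 1 / 2" and T: "0 < T"
  obtains c r where "0 < c" "0 < r"
    and "\<And>\<epsilon>. 0 < \<epsilon> \<Longrightarrow> \<epsilon> \<le> r \<Longrightarrow>
      small_ball_prob T (\<lambda>t \<omega>. B t \<omega> + W t \<omega>) \<epsilon> \<le> exp (- (c * \<epsilon> powr (- (1 / H))))"
proof -
  define c0 where "c0 = 2 - 2 powr (2 * H)"
  have "2 powr (2 * H) < 2 powr (1 :: real)" using H by (intro powr_less_mono) auto
  then have c0: "0 < c0" by (simp add: c0_def)
  \<comment> \<open>Solves \<open>c0 * \<kappa> powr (2 * H) = exp 6\<close>, so that the square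
    root is at least \<open>exp 3\<close>.\<close>
  define \<kappa> where "\<kappa> = (exp 6 / c0) powr (1 / (2 * H))"
  have \<kappa>: "0 < \<kappa>" "\<kappa> powr (2 * H) = exp 6 / c0"
    using c0 H by (auto simp: \<kappa>_def powr_powr)
  show thesis
  proof (rule that[of "T / (4 * \<kappa>)" "(T / (4 * \<kappa>)) powr H"])
    show "0 < T / (4 * \<kappa>)" "0 < (T / (4 * \<kappa>)) powr H" using T \<kappa> by auto
    fix \<epsilon> :: real assume \<epsilon>: "0 < \<epsilon>" "\<epsilon> \<le> (T / (4 * \<kappa>)) powr H"
    define z where "z = \<epsilon> powr (1 / H)"
    have z: "0 < z" "z \<le> T / (4 * \<kappa>)"
    proof -
      show "0 < z" using \<epsilon> by (simp add: z_def)
      have "z \<le> ((T / (4 * \<kappa>)) powr H) powr (1 / H)" unfolding z_def using \<epsilon> H by (intro powr_mono2) auto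
      then show "z \<le> T / (4 * \<kappa>)" using T \<kappa> H by (simp add: powr_powr)
    qed
    define u where "u = \<kappa> * z"
    have u: "0 < u" using \<kappa> z by (simp add: u_def)
    \<comment> \<open>The bound on \<open>\<epsilon>\<close> guarantees this, and it lets the floor
      lose at most half of \<open>T / (2 * u)\<close>.\<close>
    have Tu: "1 \<le> T / (4 * u)" using z \<kappa> by (simp add: u_def field_simps)
    define n where "n = nat \<lfloor>T / (2 * u)\<rfloor>"
    have half: "T / (2 * u) = T / (4 * u) + T / (4 * u)" by (simp add: field_simps)
    have n: "real n \<le> T / (2 * u)" "T / (4 * u) \<le> real n"
    proof -
      have "0 \<le> T / (2 * u)" using T u by simp
      then show "real n \<le> T / (2 * u)" unfolding n_def by linarith
      have "T / (2 * u) - 1 \<le> real n" unfolding n_def by linarith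
      then show "T / (4 * u) \<le> real n" using Tu half by linarith
    qed
    have nT: "2 * real n * u \<le> T" using n(1) u by (simp add: pos_le_divide_eq mult_ac)
    have b: "c0 * u powr (2 * H) / \<epsilon>\<^sup>2 = exp 6"
    proof -
      have "z powr (2 * H) = \<epsilon>\<^sup>2" using \<epsilon> H by (simp add: z_def powr_powr powr_numeral)
      then show ?thesis using \<kappa> z c0 \<epsilon> by (simp add: u_def powr_mult)
    qed
    have exp3: "exp 3 \<le> sqrt (1 + exp (6::real))"
    proof (rule real_le_rsqrt)
      show "(exp 3)\<^sup>2 \<le> 1 + exp (6::real)" by (simp add: exp_double[symmetric])
    qed
    have ratio: "exp 2 / sqrt (1 + exp (6::real)) \<le> exp (- 1)"
    proof -
      have "exp 2 / sqrt (1 + exp (6::real)) \<le> exp 2 / exp 3"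
      proof (rule divide_left_mono[OF exp3])
        have "0 < sqrt (1 + exp (6::real))" by (simp add: add_pos_pos)
        then show "0 < sqrt (1 + exp (6::real)) * exp 3" by simp
      qed simp
      also have "\<dots> = exp (- 1 :: real)" by (simp add: exp_diff[symmetric])
      finally show ?thesis .
    qed
    have "small_ball_prob T (\<lambda>t \<omega>. B t \<omega> + W t \<omega>) \<epsilon> \<le> (exp 2 / sqrt (1 + exp 6)) ^ n"
      using mixed_small_ball_le[OF B H W ind T \<epsilon>(1) u nT] unfolding c0_def[symmetric] b .
    also have "\<dots> \<le> exp (- 1) ^ n" using ratio by (intro power_mono) auto
    also have "\<dots> = exp (- real n)" by (simp add: exp_of_nat_mult[symmetric])
    also have "\<dots> \<le> exp (- (T / (4 * u)))" using n(2) by simp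
    also have "T / (4 * u) = T / (4 * \<kappa>) * \<epsilon> powr (- (1 / H))"
      by (simp add: u_def z_def powr_minus field_simps)
    finally show "small_ball_prob T (\<lambda>t \<omega>. B t \<omega> + W t \<omega>) \<epsilon> \<le> exp (- (T / (4 * \<kappa>) * \<epsilon> powr (- (1 / H))))" .
  qed
qed

end

theorem lemma4p1:
  fixes M :: "'a measure" and B W :: "real \<Rightarrow> 'a \<Rightarrow> real" and H T :: real
  assumes "prob_space M"
    and "0 < H" and "H < 1 / 2" and "0 < T"
    and "prob_space.fractional_brownian_motion M H B"
    and "prob_space.wiener_process M W"
    and "prob_space.independent_processes M B W"
  shows "same_order_at_0
           (\<lambda>\<epsilon>. - ln (prob_space.small_ball_prob M T (\<lambda>t \<omega>. B t \<omega> + W t \<omega>) \<epsilon>))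
           (\<lambda>\<epsilon>. \<epsilon> powr (- (1 / H)))"
proof -
  interpret prob_space M by fact
  define P where "P \<epsilon> = small_ball_prob T (\<lambda>t \<omega>. B t \<omega> + W t \<omega>) \<epsilon>" for \<epsilon>
  define g where "g \<epsilon> = \<epsilon> powr (- (1 / H))" for \<epsilon> :: real
  obtain C where C: "0 < C" "\<And>\<epsilon>. 0 < \<epsilon> \<Longrightarrow> \<epsilon> \<le> T powr H \<Longrightarrow> exp (- (C * g \<epsilon>)) \<le> P \<epsilon>"
    using mixed_small_ball_ge[OF assms(5,6,7,2,3,4)] unfolding P_def g_def by blast
  obtain c r where c: "0 < c" "0 < r" "\<And>\<epsilon>. 0 < \<epsilon> \<Longrightarrow> \<epsilon> \<le> r \<Longrightarrow> P \<epsilon> \<le> exp (- (c * g \<epsilon>))"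
    using mixed_small_ball_exp_le[OF assms(5,6,7,2,3,4)] unfolding P_def g_def by blast
  \<comment> \<open>Taking \<open>max c C\<close> secures the ordering of the two constants that
    \<open>same_order_at_0\<close> demands.\<close>
  have "\<forall>\<^sub>F \<epsilon> in at_right 0. c * g \<epsilon> \<le> - ln (P \<epsilon>) \<and> - ln (P \<epsilon>) \<le> max c C * g \<epsilon>"
  proof (rule eventually_at_rightI)
    show "0 < min r (T powr H)" using c \<open>0 < T\<close> by simp
    fix \<epsilon> assume "\<epsilon> \<in> {0<..<min r (T powr H)}"
    then have \<epsilon>: "exp (- (C * g \<epsilon>)) \<le> P \<epsilon>" "P \<epsilon> \<le> exp (- (c * g \<epsilon>))"
      by (auto intro: C(2) c(3))
    \<comment> \<open>Logarithms can be compared only for positive arguments; positivity of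
      \<open>P\<close> comes from the exponential lower bound.\<close>
    have pos: "0 < P \<epsilon>" using \<epsilon>(1) by (rule less_le_trans[OF exp_gt_zero])
    have "ln (exp (- (C * g \<epsilon>))) \<le> ln (P \<epsilon>)" "ln (P \<epsilon>) \<le> ln (exp (- (c * g \<epsilon>)))"
      using \<epsilon> pos by (simp_all only: ln_le_cancel_iff exp_gt_zero)
    moreover have "C * g \<epsilon> \<le> max c C * g \<epsilon>" by (intro mult_right_mono) (auto simp: g_def)
    ultimately show "c * g \<epsilon> \<le> - ln (P \<epsilon>) \<and> - ln (P \<epsilon>) \<le> max c C * g \<epsilon>" by simp
  qed
  then show ?thesis
    unfolding same_order_at_0_def P_def g_def using \<open>0 < c\<close> by (intro exI[of _ c] exI[of _ "max c C"]) simp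
qed

end
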